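(* Let $n \ge 1$ and $0 \le m \le n$ be integers. Then \[ n \cdot \widetilde{F}_{n,m} = \widetilde{M}_{n,m}. \]
   Context: $[n]=\{1,\dots,n\}$. Parking process: given $0\le m\le n$, a sequence $s\in[n]^m$ and a digraph $D$ with vertex set $[n]$ (loops allowed), drivers $1,\dots,m$ attempt to park one by one, in this order. Driver $i$ begins at vertex $s_i$. If the current vertex is unoccupied, the driver parks there; if it is occupied, the driver chooses an out-neighbor of the current vertex and drives there, and repeats this until she parks (and then the next driver enters) or is unable to find an available spot (and then the process terminates). Thus each driver follows a directed walk of her choice starting at $s_i$ and parks at the first unoccupied vertex on it. The sequence $s$ is a parking function on $D$ if it is possible (for some choices of the drivers) for all $m$ drivers to park. Let $P(D,m)$ be the number of $s\in[n]^m$ that are parking functions on $D$. $\widetilde{\mathcal{T}}_n$ is the set of all source trees on vertex set $[n]$: rooted (labeled) trees with vertex set $[n]$ with all edges oriented away from the root. For $f:[n]\to[n]$, the inverse mapping digraph $\widetilde{M}_f$ has vertex set $[n]$ and edge set $\{(f(i),i) : i\in[n]\}$ (the edge $(a,b)$ is directed from $a$ to $b$; loops allowed). $\widetilde{\mathcal{M}}_n$ is the set of all $\widetilde{M}_f$ with $f:[n]\to[n]$. Define \[ \widetilde{F}_{n,m}=\sum_{\widetilde{T}\in\widetilde{\mathcal{T}}_n}P(\widetilde{T},m),\qquad \widetilde{M}_{n,m}=\sum_{\widetilde{M}\in\widetilde{\mathcal{M}}_n}P(\widetilde{M},m). \] *)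

theory Defs
  imports "Graph_Theory.Graph_Theory"
begin

text \<open>
  \<open>drives_to D occ v w\<close>: with \<open>occ\<close> the set of occupied vertices, a driver currently at \<open>v\<close>
  can, by suitable choices of out-neighbours, end up parking at \<open>w\<close>. The driver has to park
  as soon as the current vertex is unoccupied.
\<close>

inductive drives_to :: "'a pair_pre_digraph \<Rightarrow> 'a set \<Rightarrow> 'a \<Rightarrow> 'a \<Rightarrow> bool"
  for D :: "'a pair_pre_digraph" and occ :: "'a set" where
  park: "v \<in> pverts D \<Longrightarrow> v \<notin> occ \<Longrightarrow> drives_to D occ v v"
| drive: "v \<in> occ \<Longrightarrow> (v, u) \<in> parcs D \<Longrightarrow> drives_to D occ u w \<Longrightarrow> drives_to D occ v w"

primrec can_all_park :: "'a pair_pre_digraph \<Rightarrow> 'a set \<Rightarrow> 'a list \<Rightarrow> bool" where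
  "can_all_park D occ [] \<longleftrightarrow> True"
| "can_all_park D occ (v # s) \<longleftrightarrow> (\<exists>w. drives_to D occ v w \<and> can_all_park D (insert w occ) s)"

definition parking_function :: "'a pair_pre_digraph \<Rightarrow> 'a list \<Rightarrow> bool" where
  "parking_function D s \<longleftrightarrow> set s \<subseteq> pverts D \<and> can_all_park D {} s"

definition num_parking_functions :: "'a pair_pre_digraph \<Rightarrow> nat \<Rightarrow> nat" where
  "num_parking_functions D m = card {s. length s = m \<and> parking_function D s}"

text \<open>
  Undirected graphs are symmetric loop-free digraphs, as in Graph_Theory
  (\<^locale>\<open>pair_graph\<close>). Its notion \<^const>\<open>pre_digraph.cycle\<close> also admits closed walks of
  length 2 traversing an edge back and forth, so acyclicity means that no cycle has
  length at least 3. (For the same reason \<^const>\<open>forest\<close> and \<^const>\<open>tree\<close> are not usable here.)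
\<close>

definition undirected_tree :: "'a pair_pre_digraph \<Rightarrow> bool" where
  "undirected_tree T \<longleftrightarrow> pair_graph T \<and> connected (with_proj T) \<and>
     \<not> (\<exists>p. pre_digraph.cycle (with_proj T) p \<and> length p \<ge> 3)"

text \<open>
  An edge between \<open>a\<close> and \<open>b\<close> is oriented from \<open>a\<close> to \<open>b\<close> iff a path starting at the root \<open>r\<close>
  has \<open>(a, b)\<close> as its last step. In a tree this selects exactly one of the two orientations.
\<close>

definition orient_away :: "'a pair_pre_digraph \<Rightarrow> 'a \<Rightarrow> 'a pair_pre_digraph" where
  "orient_away T r = \<lparr> pverts = pverts T,
     parcs = {(a, b). (a, b) \<in> parcs T \<and> (\<exists>p. pre_digraph.apath (with_proj T) r (p @ [(a, b)]) b)} \<rparr>"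

definition source_trees :: "nat \<Rightarrow> nat pair_pre_digraph set" where
  "source_trees n =
     {orient_away T r | T r. undirected_tree T \<and> pverts T = {1..n} \<and> r \<in> {1..n}}"

definition inverse_mapping_digraph :: "nat \<Rightarrow> (nat \<Rightarrow> nat) \<Rightarrow> nat pair_pre_digraph" where
  "inverse_mapping_digraph n f = \<lparr> pverts = {1..n}, parcs = {(f i, i) | i. i \<in> {1..n}} \<rparr>"

definition inverse_mapping_digraphs :: "nat \<Rightarrow> nat pair_pre_digraph set" where
  "inverse_mapping_digraphs n = {inverse_mapping_digraph n f | f. f \<in> {1..n} \<rightarrow> {1..n}}"

definition source_tree_parking_total :: "nat \<Rightarrow> nat \<Rightarrow> nat" where
  "source_tree_parking_total n m = (\<Sum>D\<in>source_trees n. num_parking_functions D m)"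

definition inverse_mapping_parking_total :: "nat \<Rightarrow> nat \<Rightarrow> nat" where
  "inverse_mapping_parking_total n m = (\<Sum>D\<in>inverse_mapping_digraphs n. num_parking_functions D m)"

text \<open>All index sets involved are finite, so no sum or cardinality is vacuously 0.\<close>

lemma finite_digraphs_on:
  assumes "finite V"
  shows "finite {D :: 'a pair_pre_digraph. pverts D = V \<and> parcs D \<subseteq> V \<times> V}"
proof -
  have "{D :: 'a pair_pre_digraph. pverts D = V \<and> parcs D \<subseteq> V \<times> V}
      \<subseteq> (\<lambda>A. \<lparr> pverts = V, parcs = A \<rparr>) ` Pow (V \<times> V)"
  proof
    fix D :: "'a pair_pre_digraph"
    assume "D \<in> {D. pverts D = V \<and> parcs D \<subseteq> V \<times> V}"
    then show "D \<in> (\<lambda>A. \<lparr> pverts = V, parcs = A \<rparr>) ` Pow (V \<times> V)"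
      by (intro image_eqI[of _ _ "parcs D"]) auto
  qed
  then show ?thesis
    using assms finite_subset by blast
qed

lemma finite_source_trees: "finite (source_trees n)"
proof (rule finite_subset[OF _ finite_digraphs_on])
  show "source_trees n \<subseteq> {D. pverts D = {1..n} \<and> parcs D \<subseteq> {1..n} \<times> {1..n}}"
  proof
    fix D assume "D \<in> source_trees n"
    then obtain T r where T: "D = orient_away T r" "undirected_tree T" "pverts T = {1..n}"
      by (auto simp: source_trees_def)
    then interpret pair_graph T by (simp add: undirected_tree_def)
    show "D \<in> {D. pverts D = {1..n} \<and> parcs D \<subseteq> {1..n} \<times> {1..n}}"
      using T in_arcsD1 in_arcsD2 by (fastforce simp: orient_away_def)
  qed
qed simp

lemma finite_inverse_mapping_digraphs: "finite (inverse_mapping_digraphs n)"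
  by (rule finite_subset[OF _ finite_digraphs_on[of "{1..n}"]])
    (auto simp: inverse_mapping_digraphs_def inverse_mapping_digraph_def)

lemma finite_parking_functions:
  assumes "finite (pverts D)"
  shows "finite {s. length s = m \<and> parking_function D s}"
  by (rule finite_subset[OF _ finite_lists_length_eq[OF assms, of m]])
    (auto simp: parking_function_def)

end

theory Submission
  imports Defs "HOL-Combinatorics.Cycles" "HOL-Combinatorics.Multiset_Permutations"
    "HOL-Library.While_Combinator"
begin

text \<open>
  Fix the preferences \<open>s\<close> and compare, for this \<open>s\<close> alone, the source trees with the maps \<open>f\<close> for
  which \<open>s\<close> is a parking function; summing over \<open>s\<close> then gives the theorem.

  Whether \<open>s\<close> is a parking function is decided by a condition of Hall type
  (\<open>parking_function_iff\<close>): every set of vertices closed under out-neighbours must contain at least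
  as many vertices as drivers that start in it. Give the vertex \<open>x\<close> the weight one minus the number
  of drivers that prefer \<open>x\<close>; the condition says that every closed set has nonnegative weight. A
  source tree is the inverse mapping digraph of its parent map, with the root mapped to itself,
  apart from the loop at the root, and loops do not matter for closedness. So both sides count
  functions \<open>f\<close> on the vertex set such that every set closed under preimages of \<open>f\<close> has nonnegative
  weight; on the left \<open>f\<close> has to be a parent map and carries a marked vertex, because of the factor
  \<open>n\<close>.

  As in Joyal's proof of Cayley's formula, cut both kinds of objects. Removing the arcs along the
  path from the marked vertex to the root of a tree leaves a forest together with a linear order of
  its roots; removing the arcs between the recurrent vertices of a map leaves a forest together with
  a permutation of its roots. Collect in each root the weight of its tree. The condition then splits
  into one on the forest alone, the same on both sides, and one on the roots
  (\<open>nonneg_closed_attach\<close>): for an order, all prefixes have nonnegative weight; for a permutation,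
  all cycles have nonnegative weight. What remains is the lemma of Sparre Andersen and Spitzer that,
  for arbitrary weights on a finite set, as many orders have nonnegative prefix sums as permutations
  have nonnegative cycle sums (\<open>card_good_orders_eq_good_perms\<close>). Permutations satisfy a recurrence
  that splits off the cycle through a given element; orders are shown to satisfy the same recurrence
  (\<open>card_good_orders_by_block\<close>).
\<close>

section \<open>Parking as a capacity condition on closed vertex sets\<close>

definition closed_under :: "('a \<times> 'a) set \<Rightarrow> 'a set \<Rightarrow> bool" where
  "closed_under E Q \<longleftrightarrow> (\<forall>(u, v)\<in>E. u \<in> Q \<longrightarrow> v \<in> Q)"

text \<open>
  Each vertex offers one parking spot, so the weight of a set is the number of its spots minus the
  number of drivers that prefer one of them.
\<close>

definition weight :: "'a list \<Rightarrow> 'a \<Rightarrow> int" where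
  "weight s x = 1 - int (count_list s x)"

lemma sum_weight_Cons:
  assumes "finite Q"
  shows "sum (weight (v # s)) Q = sum (weight s) Q - (if v \<in> Q then 1 else 0)"
proof -
  have "sum (weight (v # s)) Q = (\<Sum>x\<in>Q. weight s x - (if x = v then 1 else 0))"
    by (intro sum.cong) (auto simp: weight_def)
  then show ?thesis
    using assms by (simp add: sum_subtractf)
qed

lemma drives_to_unoccupied: "drives_to D occ v w \<Longrightarrow> w \<notin> occ"
  by (induction rule: drives_to.induct)

lemma drives_to_closed:
  "drives_to D occ v w \<Longrightarrow> closed_under (parcs D) Q \<Longrightarrow> v \<in> Q \<Longrightarrow> w \<in> Q"
  by (induction rule: drives_to.induct) (auto simp: closed_under_def)

lemma drives_to_vertex: "drives_to D occ v w \<Longrightarrow> w \<in> pverts D"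
  by (induction rule: drives_to.induct)

text \<open>
  A driver that starts in a closed set also parks in it, so the drivers still to come and the
  vertices already occupied compete for the vertices of the set.
\<close>

lemma can_all_park_imp_capacity:
  assumes "can_all_park D occ s" "closed_under (parcs D) Q" "finite Q"
  shows "int (card (occ \<inter> Q)) \<le> sum (weight s) Q"
  using assms(1)
proof (induction s arbitrary: occ)
  case Nil
  then show ?case
    using assms(3) by (simp add: weight_def card_mono)
next
  case (Cons v s)
  then obtain w where w: "drives_to D occ v w" "can_all_park D (insert w occ) s"
    by auto
  have IH: "int (card (insert w occ \<inter> Q)) \<le> sum (weight s) Q"
    using Cons.IH w(2) by blast
  have fin: "finite (occ \<inter> Q)" using assms(3) by blast
  show ?case
  proof (cases "v \<in> Q")
    case True
    then have "w \<in> Q" using drives_to_closed w(1) assms(2) by metis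
    then have "card (insert w occ \<inter> Q) = Suc (card (occ \<inter> Q))"
      using drives_to_unoccupied[OF w(1)] fin by simp
    then show ?thesis using IH True assms(3) by (simp add: sum_weight_Cons)
  next
    case False
    have "card (occ \<inter> Q) \<le> card (insert w occ \<inter> Q)"
      using assms(3) by (intro card_mono) auto
    then show ?thesis using IH False assms(3) by (simp add: sum_weight_Cons)
  qed
qed

text \<open>
  Each driver has to avoid the tight sets, that is, the closed sets whose free vertices are all
  needed by the later drivers. The tight sets are closed under union, because the slack of a set is
  modular, so there is a largest one. If all vertices where the driver can end up belonged to it,
  then adding to it the occupied vertices from which there is no way out of it would give a closed
  set that contains the driver's start but violates the capacity condition.
\<close>

lemma capacity_imp_can_all_park:
  assumes "finite (pverts D)" "pair_wf_digraph D" "set s \<subseteq> pverts D" "occ \<subseteq> pverts D"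
    and "\<And>Q. Q \<subseteq> pverts D \<Longrightarrow> closed_under (parcs D) Q \<Longrightarrow>
           int (card (occ \<inter> Q)) \<le> sum (weight s) Q"
  shows "can_all_park D occ s"
  using assms(3-5)
proof (induction s arbitrary: occ)
  case Nil
  then show ?case by simp
next
  case (Cons v s)
  let ?V = "pverts D"
  define slack where "slack Q = sum (weight s) Q - int (card (occ \<inter> Q))" for Q
  have slack_sum: "slack Q = (\<Sum>x\<in>Q. weight s x - (if x \<in> occ then 1 else 0))"
    if "Q \<subseteq> ?V" for Q
    using finite_subset[OF that assms(1)]
    by (simp add: slack_def sum_subtractf sum.If_cases Int_commute)
  \<comment> \<open>The hypothesis counts the driver at \<open>v\<close> as well, hence the gain of one where \<open>v \<in> Q\<close>.\<close>
  have slack: "(if v \<in> Q then 1 else 0) \<le> slack Q" if "Q \<subseteq> ?V" "closed_under (parcs D) Q" for Q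
    using Cons.prems(3)[OF that] finite_subset[OF that(1) assms(1)]
    by (simp add: slack_def sum_weight_Cons)
  define tight where "tight Q \<longleftrightarrow> Q \<subseteq> ?V \<and> closed_under (parcs D) Q \<and> slack Q = 0" for Q
  have tight_Un: "tight (A \<union> B)" if "tight A" "tight B" for A B
  proof -
    have AB: "A \<subseteq> ?V" "B \<subseteq> ?V" "closed_under (parcs D) A" "closed_under (parcs D) B"
      "slack A = 0" "slack B = 0"
      using that by (auto simp: tight_def)
    then have fin: "finite A" "finite B" using assms(1) finite_subset by auto
    have cl: "closed_under (parcs D) (A \<union> B)" "closed_under (parcs D) (A \<inter> B)"
      using AB by (auto simp: closed_under_def)
    have "slack (A \<union> B) + slack (A \<inter> B) = slack A + slack B"
      using AB fin by (simp add: slack_sum le_infI1 sum.union_inter)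
    moreover have "A \<inter> B \<subseteq> ?V" using AB by blast
    then have "slack (A \<union> B) \<ge> 0" "slack (A \<inter> B) \<ge> 0"
      using slack[of "A \<union> B"] slack[of "A \<inter> B"] AB cl by (auto split: if_splits)
    ultimately show ?thesis using AB cl by (auto simp: tight_def)
  qed
  define full where "full = \<Union> {Q. tight Q}"
  have fin_tight: "finite {Q. tight Q}"
    by (rule finite_subset[of _ "Pow ?V"]) (use assms(1) in \<open>auto simp: tight_def\<close>)
  have "tight (\<Union> \<Q>)" if "finite \<Q>" "\<Q> \<subseteq> {Q. tight Q}" for \<Q>
    using that
  proof (induction rule: finite_induct)
    case empty
    then show ?case by (simp add: tight_def slack_def closed_under_def)
  next
    case (insert Q \<Q>)
    then show ?case using tight_Un by auto
  qed
  then have full: "full \<subseteq> ?V" "closed_under (parcs D) full" "slack full = 0"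
    using fin_tight by (auto simp: full_def tight_def)
  have fin_full: "finite full" using full(1) assms(1) finite_subset by blast
  \<comment> \<open>Occupied vertices from which a driver can park only in \<open>full\<close>.\<close>
  define stuck where "stuck = {u \<in> occ. \<forall>w. drives_to D occ u w \<longrightarrow> w \<in> full}"
  have stuck_V: "stuck \<subseteq> ?V" using Cons.prems by (auto simp: stuck_def)
  have closed: "closed_under (parcs D) (full \<union> stuck)"
  proof -
    have "b \<in> full \<union> stuck" if ab: "(a, b) \<in> parcs D" and a: "a \<in> stuck" for a b
    proof (cases "b \<in> occ")
      case True
      have "w \<in> full" if "drives_to D occ b w" for w
        using drives_to.drive[of a occ b D w] that ab a by (auto simp: stuck_def)
      then show ?thesis using True by (auto simp: stuck_def)
    next
      case False
      have "b \<in> ?V" using assms(2) ab by (rule pair_wf_digraph.in_arcsD2)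
      then have "drives_to D occ a b"
        using False ab a by (auto simp: stuck_def intro: drives_to.intros)
      then show ?thesis using a by (auto simp: stuck_def)
    qed
    then show ?thesis using full(2) by (auto simp: closed_under_def)
  qed
  have "\<exists>w. drives_to D occ v w \<and> w \<notin> full"
  proof (rule ccontr)
    assume "\<not> ?thesis"
    then have all: "w \<in> full" if "drives_to D occ v w" for w using that by blast
    have "v \<in> full \<union> stuck"
    proof (cases "v \<in> occ")
      case False
      then have "drives_to D occ v v"
        using Cons.prems(1) by (auto intro: drives_to.park)
      then show ?thesis using all by blast
    qed (use all in \<open>auto simp: stuck_def\<close>)
    then have "1 \<le> slack (full \<union> stuck)"
      using slack[OF _ closed] full(1) stuck_V by auto
    also have "slack (full \<union> stuck) =
        slack full + (\<Sum>x\<in>stuck - full. weight s x - (if x \<in> occ then 1 else 0))"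
      using full(1) stuck_V fin_full finite_subset[OF stuck_V assms(1)]
        sum.union_disjoint[of full "stuck - full" "\<lambda>x. weight s x - (if x \<in> occ then 1 else 0)"]
      by (simp add: slack_sum Diff_disjoint)
    also have "\<dots> \<le> 0"
      using full(3) by (auto simp: stuck_def weight_def intro: sum_nonpos)
    finally show False by simp
  qed
  then obtain w where w: "drives_to D occ v w" "w \<notin> full" by blast
  have "can_all_park D (insert w occ) s"
  proof (rule Cons.IH)
    show "set s \<subseteq> ?V" using Cons.prems(1) by simp
    show "insert w occ \<subseteq> ?V" using Cons.prems(2) drives_to_vertex[OF w(1)] by simp
    fix Q assume Q: "Q \<subseteq> ?V" "closed_under (parcs D) Q"
    have fin: "finite (occ \<inter> Q)" using finite_subset[OF Q(1) assms(1)] by simp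
    show "int (card (insert w occ \<inter> Q)) \<le> sum (weight s) Q"
    proof (cases "w \<in> Q")
      case True
      then have "\<not> tight Q" using w(2) by (auto simp: full_def)
      then have "1 \<le> slack Q" using slack[OF Q] Q by (auto simp: tight_def split: if_splits)
      moreover have "int (card (insert w occ \<inter> Q)) \<le> int (card (occ \<inter> Q)) + 1"
        using True fin by (simp add: card_insert_if)
      ultimately show ?thesis by (simp add: slack_def)
    next
      case False
      then show ?thesis using slack[OF Q] by (auto simp: slack_def split: if_splits)
    qed
  qed
  then show ?case using w(1) by auto
qed

lemma parking_function_iff:
  assumes "finite (pverts D)" "pair_wf_digraph D"
  shows "parking_function D s \<longleftrightarrow> set s \<subseteq> pverts D \<and>
    (\<forall>Q\<subseteq>pverts D. closed_under (parcs D) Q \<longrightarrow> 0 \<le> sum (weight s) Q)"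
proof (intro iffI conjI allI impI)
  assume "set s \<subseteq> pverts D \<and>
    (\<forall>Q\<subseteq>pverts D. closed_under (parcs D) Q \<longrightarrow> 0 \<le> sum (weight s) Q)"
  then show "parking_function D s"
    using capacity_imp_can_all_park[OF assms, of s "{}"] by (auto simp: parking_function_def)
next
  fix Q assume "parking_function D s" "Q \<subseteq> pverts D" "closed_under (parcs D) Q"
  then show "0 \<le> sum (weight s) Q"
    using can_all_park_imp_capacity[of D "{}" s Q] finite_subset[OF _ assms(1)]
    by (auto simp: parking_function_def)
qed (auto simp: parking_function_def)

section \<open>Orders with nonnegative prefix sums and permutations with nonnegative cycles\<close>

text \<open>
  The elements are listed from the marked vertex towards the root when such an order is read as a
  path in a tree.
\<close>

definition good_orders :: "('a \<Rightarrow> int) \<Rightarrow> 'a set \<Rightarrow> 'a list set" where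
  "good_orders a S =
     {p. distinct p \<and> set p = S \<and> (\<forall>k\<le>length p. 0 \<le> sum a (set (take k p)))}"

lemma finite_good_orders: "finite S \<Longrightarrow> finite (good_orders a S)"
  by (rule finite_subset[OF _ finite_subset_distinct[of S]]) (auto simp: good_orders_def)

lemma card_good_orders_empty: "card (good_orders a {}) = 1"
proof -
  have "good_orders a {} = {[]}" by (auto simp: good_orders_def)
  then show ?thesis by simp
qed

text \<open>
  This counts the orders of \<open>S\<close> whose proper prefixes all have nonnegative sum, sorted by their last
  element; the sum over \<open>S\<close> itself may be negative. For \<open>S = {}\<close> the value is 0.
\<close>

definition num_almost_good :: "('a \<Rightarrow> int) \<Rightarrow> 'a set \<Rightarrow> nat" where
  "num_almost_good a S = (\<Sum>x\<in>S. card (good_orders a (S - {x})))"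

lemma card_good_orders:
  assumes "finite S" "S \<noteq> {}"
  shows "card (good_orders a S) = (if 0 \<le> sum a S then num_almost_good a S else 0)"
proof (cases "0 \<le> sum a S")
  case True
  have "good_orders a S = (\<Union>x\<in>S. (\<lambda>p. p @ [x]) ` good_orders a (S - {x}))"
  proof (intro equalityI subsetI)
    fix p assume p: "p \<in> good_orders a S"
    then obtain x p' where p': "p = p' @ [x]"
      using assms(2) by (cases p rule: rev_cases) (auto simp: good_orders_def)
    have "0 \<le> sum a (set (take k p'))" if "k \<le> length p'" for k
    proof -
      have "k \<le> length p" "take k p = take k p'" using that by (auto simp: p')
      then show ?thesis using p by (auto simp: good_orders_def)
    qed
    then show "p \<in> (\<Union>x\<in>S. (\<lambda>p. p @ [x]) ` good_orders a (S - {x}))"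
      using p by (auto simp: good_orders_def p')
  next
    fix p assume "p \<in> (\<Union>x\<in>S. (\<lambda>p. p @ [x]) ` good_orders a (S - {x}))"
    then obtain x p' where "x \<in> S" "p = p' @ [x]" "p' \<in> good_orders a (S - {x})" by auto
    then show "p \<in> good_orders a S"
      using True by (auto simp: good_orders_def insert_absorb le_Suc_eq)
  qed
  also have "card \<dots> = (\<Sum>x\<in>S. card ((\<lambda>p. p @ [x]) ` good_orders a (S - {x})))"
    using assms(1) by (intro card_UN_disjoint) (auto simp: finite_good_orders)
  also have "\<dots> = num_almost_good a S"
    unfolding num_almost_good_def by (intro sum.cong card_image) (auto simp: inj_on_def)
  finally show ?thesis using True by simp
next
  case False
  then have "good_orders a S = {}" by (auto simp: good_orders_def)
  then show ?thesis using False by simp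
qed

text \<open>
  An order that is not good has a first prefix with negative sum. If \<open>V\<close> is the set of its
  elements, then \<open>V\<close> is ordered with nonnegative proper prefixes while the order of the rest is
  arbitrary. Instead of building this bijection, the proof removes the last element on both sides.
\<close>

lemma fact_eq_good_orders_plus:
  assumes "finite S"
  shows "fact (card S) = card (good_orders a S) +
    (\<Sum>V | V \<subseteq> S \<and> sum a V < 0. num_almost_good a V * fact (card S - card V))"
  using assms
proof (induction "card S" arbitrary: S)
  case 0
  then have "S = {}" by simp
  moreover have "{V. V \<subseteq> {} \<and> sum a V < 0} = {}" by auto
  ultimately show ?case by (simp only: card_good_orders_empty) simp
next
  case (Suc n)
  then have ne: "S \<noteq> {}" by auto
  let ?neg = "\<lambda>S. {V. V \<subseteq> S \<and> sum a V < 0}"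
  let ?D = "num_almost_good a"
  have fin: "finite (?neg T)" if "T \<subseteq> S" for T
    using finite_subset[OF that Suc.prems] by simp
  have card_less: "card V \<le> n" if "V \<subseteq> S" "V \<noteq> S" for V
    using psubset_card_mono[OF Suc.prems, of V] Suc.hyps(2) that by (simp add: psubset_eq)
  have "fact (card S) = (\<Sum>x\<in>S. fact (card (S - {x})))"
    using Suc.hyps(2) Suc.prems by (simp flip: Suc.hyps(2))
  also have "\<dots> = (\<Sum>x\<in>S. card (good_orders a (S - {x})) +
      (\<Sum>V\<in>?neg (S - {x}). ?D V * fact (n - card V)))"
  proof (rule sum.cong)
    fix x assume x: "x \<in> S"
    then have "n = card (S - {x})" using Suc.prems by (simp flip: Suc.hyps(2))
    then show "fact (card (S - {x})) = card (good_orders a (S - {x})) +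
      (\<Sum>V\<in>?neg (S - {x}). ?D V * fact (n - card V))"
      using Suc.hyps(1)[of "S - {x}"] Suc.prems by simp
  qed simp
  also have "\<dots> = ?D S + (\<Sum>x\<in>S. \<Sum>V\<in>?neg (S - {x}). ?D V * fact (n - card V))"
    by (simp add: sum.distrib num_almost_good_def)
  also have "(\<Sum>x\<in>S. \<Sum>V\<in>?neg (S - {x}). ?D V * fact (n - card V)) =
      (\<Sum>x\<in>S. \<Sum>V | V \<in> ?neg S - {S} \<and> x \<notin> V. ?D V * fact (n - card V))"
    by (intro sum.cong refl) auto
  also have "\<dots> = (\<Sum>V\<in>?neg S - {S}. \<Sum>x | x \<in> S \<and> x \<notin> V. ?D V * fact (n - card V))"
    using fin[of S] Suc.prems by (intro sum.swap_restrict) auto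
  also have "\<dots> = (\<Sum>V\<in>?neg S - {S}. ?D V * fact (card S - card V))"
  proof (rule sum.cong)
    fix V assume V: "V \<in> ?neg S - {S}"
    have "{x \<in> S. x \<notin> V} = S - V" by auto
    moreover have "card (S - V) = Suc (n - card V)" "card S - card V = Suc (n - card V)"
      using V card_less[of V] Suc.prems Suc.hyps(2) finite_subset[of V S]
      by (auto simp: card_Diff_subset Suc_diff_le)
    ultimately show "(\<Sum>x | x \<in> S \<and> x \<notin> V. ?D V * fact (n - card V)) =
        ?D V * fact (card S - card V)"
      by (simp add: algebra_simps)
  qed simp
  also have "?D S + \<dots> = card (good_orders a S) +
      (\<Sum>V\<in>?neg S. ?D V * fact (card S - card V))"
  proof (cases "0 \<le> sum a S")
    case True
    then have "?neg S - {S} = ?neg S" by auto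
    then show ?thesis using True card_good_orders[OF Suc.prems ne, of a] by simp
  next
    case False
    then have "S \<in> ?neg S" by auto
    then show ?thesis
      using False card_good_orders[OF Suc.prems ne, of a]
        sum.remove[OF fin[of S], of S "\<lambda>V. ?D V * fact (card S - card V)"]
      by simp
  qed
  finally show ?case .
qed

text \<open>
  The recurrence that splits off the cycle through \<open>y\<close> of a permutation, now for orders. If the sum
  over \<open>S\<close> is nonnegative, then removing the last element \<open>x\<close> and applying the induction hypothesis
  for \<open>x \<noteq> y\<close> almost gives the claim: the summand for \<open>U\<close> counts the almost good orders of \<open>S - U\<close>
  instead of the good ones. The two differ only if \<open>U = S\<close> or the sum over \<open>S - U\<close> is negative. The
  excess from the latter sets, together with the orders that end in \<open>y\<close>, amounts to all orders of
  \<open>S - {y}\<close>, sorted by their first negative prefix \<open>S - U\<close>; this is exactly the missing summand for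
  \<open>U = S\<close>.
\<close>

lemma card_good_orders_by_block:
  assumes "finite S" "y \<in> S"
  shows "card (good_orders a S) = (\<Sum>U | y \<in> U \<and> U \<subseteq> S \<and> 0 \<le> sum a U.
    fact (card U - 1) * card (good_orders a (S - U)))"
  using assms
proof (induction "card S" arbitrary: S)
  case 0
  then show ?case by simp
next
  case (Suc n)
  let ?A = "\<lambda>S. card (good_orders a S)" and ?D = "num_almost_good a"
  let ?bl = "\<lambda>S. {U. y \<in> U \<and> U \<subseteq> S \<and> 0 \<le> sum a U}"
  let ?f = "\<lambda>U::'a set. fact (card U - 1) :: nat"
  have ne: "S \<noteq> {}" using Suc.prems by auto
  have fin: "finite (?bl S)" using Suc.prems by (auto intro: finite_subset[of _ "Pow S"])
  have sum_diff: "sum a (S - U) = sum a S - sum a U" if "U \<subseteq> S" for U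
    using that Suc.prems(1) by (simp add: sum_diff)
  show ?case
  proof (cases "0 \<le> sum a S")
    case False
    have "?A (S - U) = 0" if U: "U \<in> ?bl S" for U
    proof -
      have "S - U \<noteq> {}" using U False by auto
      then show ?thesis using card_good_orders[of "S - U" a] U False Suc.prems sum_diff[of U] by auto
    qed
    then show ?thesis using False card_good_orders[OF Suc.prems(1) ne, of a] by simp
  next
    case True
    have "?A S = ?A (S - {y}) + (\<Sum>x\<in>S - {y}. ?A (S - {x}))"
      using True card_good_orders[OF Suc.prems(1) ne, of a] Suc.prems
      by (simp add: num_almost_good_def sum.remove)
    also have "(\<Sum>x\<in>S - {y}. ?A (S - {x})) = (\<Sum>x\<in>S - {y}. \<Sum>U\<in>?bl (S - {x}). ?f U * ?A (S - {x} - U))"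
      using Suc.hyps Suc.prems by (intro sum.cong refl Suc.hyps(1)) auto
    also have "\<dots> = (\<Sum>x\<in>S - {y}. \<Sum>U | U \<in> ?bl S \<and> x \<notin> U. ?f U * ?A (S - U - {x}))"
      by (intro sum.cong refl) (auto intro!: arg_cong[of _ _ ?A])
    also have "\<dots> = (\<Sum>U\<in>?bl S. \<Sum>x | x \<in> S - {y} \<and> x \<notin> U. ?f U * ?A (S - U - {x}))"
      using fin Suc.prems by (intro sum.swap_restrict) auto
    also have "\<dots> = (\<Sum>U\<in>?bl S. ?f U * ?D (S - U))"
      unfolding num_almost_good_def sum_distrib_left by (intro sum.cong refl) auto
    also have "\<dots> = (\<Sum>U\<in>?bl S - {S}. ?f U * ?D (S - U))"
      using fin by (intro sum.mono_neutral_right) (auto simp: num_almost_good_def)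
    also have "\<dots> = (\<Sum>U\<in>?bl S - {S}. ?f U * ?A (S - U) +
        (if sum a (S - U) < 0 then ?D (S - U) * ?f U else 0))"
    proof (rule sum.cong)
      fix U assume U: "U \<in> ?bl S - {S}"
      then have "S - U \<noteq> {}" by auto
      then show "?f U * ?D (S - U) =
          ?f U * ?A (S - U) + (if sum a (S - U) < 0 then ?D (S - U) * ?f U else 0)"
        using card_good_orders[of "S - U" a] Suc.prems by simp
    qed simp
    also have "\<dots> = (\<Sum>U\<in>?bl S - {S}. ?f U * ?A (S - U)) +
        (\<Sum>U\<in>?bl S - {S}. if sum a (S - U) < 0 then ?D (S - U) * ?f U else 0)"
      by (rule sum.distrib)
    also have "(\<Sum>U\<in>?bl S - {S}. if sum a (S - U) < 0 then ?D (S - U) * ?f U else 0) =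
        (\<Sum>U | U \<in> ?bl S - {S} \<and> sum a (S - U) < 0. ?D (S - U) * ?f U)"
      by (rule sum.inter_filter[symmetric]) (use fin in simp)
    also have "\<dots> = (\<Sum>V | V \<subseteq> S - {y} \<and> sum a V < 0. ?D V * fact (card (S - {y}) - card V))"
    proof (rule sum.reindex_bij_witness[of _ "\<lambda>V. S - V" "\<lambda>U. S - U"])
      fix U assume U: "U \<in> {U. U \<in> ?bl S - {S} \<and> sum a (S - U) < 0}"
      then have "card (S - {y}) - card (S - U) = card U - 1"
        using Suc.prems finite_subset[of U S] card_mono[of S U] by (auto simp: card_Diff_subset)
      then show "?D (S - U) * fact (card (S - {y}) - card (S - U)) = ?D (S - U) * ?f U"
        by simp
    next
      fix V assume "V \<in> {V. V \<subseteq> S - {y} \<and> sum a V < 0}"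
      then have V: "V \<subseteq> S" "y \<notin> V" "sum a V < 0" by auto
      then have "S - (S - V) = V" by blast
      moreover have "V \<noteq> {}" using V(3) by auto
      moreover from this have "S - V \<noteq> S" using V(1) by blast
      ultimately show "S - (S - V) = V" "S - V \<in> {U. U \<in> ?bl S - {S} \<and> sum a (S - U) < 0}"
        using V True Suc.prems sum_diff[OF V(1)] by auto
    qed (use True Suc.prems sum_diff in \<open>auto simp: double_diff\<close>)
    finally have "?A S = (\<Sum>U\<in>?bl S - {S}. ?f U * ?A (S - U)) + fact (card (S - {y}))"
      using fact_eq_good_orders_plus[of "S - {y}" a] Suc.prems(1) by simp
    also have "\<dots> = (\<Sum>U\<in>?bl S. ?f U * ?A (S - U))"
      using fin True Suc.prems sum.remove[of "?bl S" S "\<lambda>U. ?f U * ?A (S - U)"]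
      by (simp add: card_good_orders_empty)
    finally show ?thesis .
  qed
qed

text \<open>
  In the digraph with the arcs \<open>(f x, x)\<close>, the sets closed under preimages of \<open>f\<close> are those closed
  under out-neighbours. If \<open>f\<close> is a permutation, they are the unions of its cycles.
\<close>

definition nonneg_closed :: "('a \<Rightarrow> int) \<Rightarrow> 'a set \<Rightarrow> ('a \<Rightarrow> 'a) \<Rightarrow> bool" where
  "nonneg_closed a S f \<longleftrightarrow>
     (\<forall>Q\<subseteq>S. (\<forall>x\<in>S. f x \<in> Q \<longrightarrow> x \<in> Q) \<longrightarrow> 0 \<le> sum a Q)"

definition good_perms :: "('a \<Rightarrow> int) \<Rightarrow> 'a set \<Rightarrow> ('a \<Rightarrow> 'a) set" where
  "good_perms a S = {\<sigma>. \<sigma> permutes S \<and> nonneg_closed a S \<sigma>}"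

lemma finite_good_perms: "finite S \<Longrightarrow> finite (good_perms a S)"
  by (rule finite_subset[OF _ finite_permutations[of S]]) (auto simp: good_perms_def)

lemma card_good_perms_empty: "card (good_perms a {}) = 1"
proof -
  have "good_perms a {} = {id}" by (auto simp: good_perms_def nonneg_closed_def)
  then show ?thesis by simp
qed

text \<open>
  If \<open>\<tau>\<close> acts outside the cycle, then the iterates of \<open>y\<close> run through the list \<open>y # l\<close>. This
  recovers the cycle from the composed permutation.
\<close>

lemma funpow_cycle_of_list_comp:
  assumes "distinct (y # l)" "\<And>x. x \<in> set (y # l) \<Longrightarrow> \<tau> x = x"
  shows "((cycle_of_list (y # l) \<circ> \<tau>) ^^ n) y = (y # l) ! (n mod length (y # l))"
proof -
  let ?c = "cycle_of_list (y # l)"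
  have *: "(?c ^^ n) y = (y # l) ! (n mod length (y # l))" for n
  proof -
    have "(?c ^^ n) y = hd (map (?c ^^ n) (y # l))" by simp
    also have "\<dots> = hd (rotate n (y # l))" by (simp only: cyclic_rotation[OF assms(1)])
    also have "\<dots> = (y # l) ! (n mod length (y # l))" by (intro hd_rotate_conv_nth) simp
    finally show ?thesis .
  qed
  have "((?c \<circ> \<tau>) ^^ n) y = (?c ^^ n) y"
  proof (induction n)
    case (Suc n)
    have "(?c ^^ n) y \<in> set (y # l)" unfolding * by (intro nth_mem) simp
    then show ?case using Suc assms(2) by (simp del: cycle_of_list.simps list.set)
  qed simp
  then show ?thesis using * by simp
qed

lemma range_funpow_cycle_of_list_comp:
  assumes "distinct (y # l)" "\<And>x. x \<in> set (y # l) \<Longrightarrow> \<tau> x = x"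
  shows "range (\<lambda>n. ((cycle_of_list (y # l) \<circ> \<tau>) ^^ n) y) = set (y # l)"
proof -
  have "range (\<lambda>n. (y # l) ! (n mod length (y # l))) = set (y # l)"
  proof (intro equalityI subsetI)
    fix x assume "x \<in> set (y # l)"
    then obtain n where "n < length (y # l)" "(y # l) ! n = x" by (auto simp only: in_set_conv_nth)
    then show "x \<in> range (\<lambda>n. (y # l) ! (n mod length (y # l)))"
      by (intro image_eqI[of _ _ n]) auto
  next
    fix x assume "x \<in> range (\<lambda>n. (y # l) ! (n mod length (y # l)))"
    then obtain n where "x = (y # l) ! (n mod length (y # l))" by blast
    then show "x \<in> set (y # l)" by (simp only:) (intro nth_mem, simp)
  qed
  then show ?thesis using funpow_cycle_of_list_comp[OF assms] by simp
qed

text \<open>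
  A set closed under preimages contains all or nothing of the cycle, so the condition separates.
\<close>

lemma nonneg_closed_cycle_comp:
  assumes "finite S" "distinct (y # l)" "set (y # l) \<subseteq> S" "\<tau> permutes (S - set (y # l))"
  shows "nonneg_closed a S (cycle_of_list (y # l) \<circ> \<tau>) \<longleftrightarrow>
    0 \<le> sum a (set (y # l)) \<and> nonneg_closed a (S - set (y # l)) \<tau>"
proof -
  define c where "c = cycle_of_list (y # l)"
  define U where "U = set (y # l)"
  have U: "y \<in> U" "U \<subseteq> S" "finite U" using assms(3) by (auto simp: U_def)
  have \<tau>U: "\<tau> x = x" if "x \<in> U" for x using assms(4) that by (auto simp: permutes_def U_def)
  have \<tau>S: "\<tau> x \<in> S - U \<longleftrightarrow> x \<in> S - U" for x
    using permutes_in_image[OF assms(4)] by (auto simp: U_def)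
  have cU: "c permutes U" unfolding c_def U_def by (rule cycle_permutes)
  then have c_out: "c x = x" if "x \<notin> U" for x using that by (auto simp: permutes_def)
  have c_in: "c x \<in> U \<longleftrightarrow> x \<in> U" for x using permutes_in_image[OF cU] by auto
  have eqU: "(c \<circ> \<tau>) x = c x" if "x \<in> U" for x using \<tau>U that by simp
  have eqS: "(c \<circ> \<tau>) x = \<tau> x" if "x \<in> S - U" for x using \<tau>S[of x] c_out that by simp
  have "(\<forall>Q\<subseteq>S. (\<forall>x\<in>S. (c \<circ> \<tau>) x \<in> Q \<longrightarrow> x \<in> Q) \<longrightarrow> 0 \<le> sum a Q) \<longleftrightarrow>
    0 \<le> sum a U \<and> (\<forall>Q\<subseteq>S - U. (\<forall>x\<in>S - U. \<tau> x \<in> Q \<longrightarrow> x \<in> Q) \<longrightarrow> 0 \<le> sum a Q)"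
    (is "?L \<longleftrightarrow> ?R")
  proof
    assume L: ?L
    show ?R
    proof (intro conjI allI impI)
      have "\<forall>x\<in>S. (c \<circ> \<tau>) x \<in> U \<longrightarrow> x \<in> U"
        using eqS \<tau>S by fastforce
      then show "0 \<le> sum a U" using L U by blast
    next
      fix Q assume Q: "Q \<subseteq> S - U" "\<forall>x\<in>S - U. \<tau> x \<in> Q \<longrightarrow> x \<in> Q"
      have "\<forall>x\<in>S. (c \<circ> \<tau>) x \<in> Q \<longrightarrow> x \<in> Q"
        using Q eqU eqS c_in by fastforce
      then show "0 \<le> sum a Q" using L Q by blast
    qed
  next
    assume R: ?R
    show ?L
    proof (intro allI impI)
      fix Q assume Q: "Q \<subseteq> S" "\<forall>x\<in>S. (c \<circ> \<tau>) x \<in> Q \<longrightarrow> x \<in> Q"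
      have fin: "finite Q" using Q(1) assms(1) finite_subset by blast
      \<comment> \<open>Starting from \<open>y\<close>, the cycle reaches all of \<open>U\<close>.\<close>
      have c_closed: "U \<subseteq> Z" if "y \<in> Z" "c ` Z \<subseteq> Z" for Z
      proof -
        have "(c ^^ n) y \<in> Z" for n using that by (induction n) auto
        then have "range (\<lambda>n. (c ^^ n) y) \<subseteq> Z" by blast
        then show ?thesis
          using range_funpow_cycle_of_list_comp[OF assms(2), of id] by (simp add: U_def c_def)
      qed
      have closed: "c ` (U - Q) \<subseteq> U - Q"
      proof
        fix z assume "z \<in> c ` (U - Q)"
        then obtain x where "x \<in> U" "x \<notin> Q" "z = c x" by blast
        then show "z \<in> U - Q" using Q(2) U(2) eqU[of x] c_in[of x] by auto
      qed
      have "Q \<inter> U = {} \<or> U \<subseteq> Q"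
      proof (cases "y \<in> Q")
        case False
        then show ?thesis using c_closed[OF _ closed] U(1) by blast
      next
        case True
        have inj: "inj c" using cU by (rule permutes_inj)
        then have "c ` (U - Q) = U - Q"
          using closed U(3) by (intro card_subset_eq) (auto simp: card_image inj_on_subset)
        then have "c x \<notin> U - Q" if "x \<in> Q" for x
          using that inj_image_mem_iff[OF inj, of x "U - Q"] by (metis DiffD2)
        then have "c ` (Q \<inter> U) \<subseteq> Q \<inter> U" using c_in by blast
        then show ?thesis using c_closed[of "Q \<inter> U"] True U(1) by blast
      qed
      moreover have "0 \<le> sum a (Q - U)"
      proof -
        have "\<forall>x\<in>S - U. \<tau> x \<in> Q - U \<longrightarrow> x \<in> Q - U"
          using Q(2) eqS by fastforce
        moreover have "Q - U \<subseteq> S - U" using Q(1) by blast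
        ultimately show ?thesis using conjunct2[OF R, rule_format, of "Q - U"] by simp
      qed
      moreover have "sum a Q = sum a (Q - U) + sum a (Q \<inter> U)"
        using sum.Int_Diff[OF fin, of a U] by simp
      ultimately show "0 \<le> sum a Q"
        using conjunct1[OF R] by (elim disjE) (simp_all add: Int_absorb1)
    qed
  qed
  then show ?thesis unfolding nonneg_closed_def c_def U_def .
qed

text \<open>
  Here \<open>U\<close> is the set of elements of the cycle through \<open>y\<close>. Reading the cycle from \<open>y\<close> onwards gives
  an arbitrary order of \<open>U - {y}\<close>, which accounts for the factorial.
\<close>

lemma card_good_perms_by_cycle:
  assumes "finite S" "y \<in> S"
  shows "card (good_perms a S) = (\<Sum>U | y \<in> U \<and> U \<subseteq> S \<and> 0 \<le> sum a U.
    fact (card U - 1) * card (good_perms a (S - U)))"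
proof -
  let ?bl = "{U. y \<in> U \<and> U \<subseteq> S \<and> 0 \<le> sum a U}"
  let ?X = "\<lambda>U. permutations_of_set (U - {y}) \<times> good_perms a (S - U)"
  let ?glue = "\<lambda>(U, l, \<tau>). cycle_of_list (y # l) \<circ> \<tau>"
  have fin: "finite ?bl" using assms(1) by (auto intro: finite_subset[of _ "Pow S"])
  have D: "distinct (y # l)" "set (y # l) = U" "\<tau> permutes (S - U)" "nonneg_closed a (S - U) \<tau>"
    "\<And>x. x \<in> U \<Longrightarrow> \<tau> x = x"
    if "U \<in> ?bl" "(l, \<tau>) \<in> ?X U" for U l \<tau>
    using that by (auto simp: good_perms_def permutations_of_set_def permutes_def insert_absorb)
  have "bij_betw ?glue (Sigma ?bl ?X) (good_perms a S)"
  proof (rule bij_betw_imageI)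
    show "inj_on ?glue (Sigma ?bl ?X)"
    proof (rule inj_onI)
      fix p q assume pq: "p \<in> Sigma ?bl ?X" "q \<in> Sigma ?bl ?X" "?glue p = ?glue q"
      then obtain U l \<tau> U' l' \<tau>' where p: "p = (U, l, \<tau>)" and q: "q = (U', l', \<tau>')"
        and UX: "U \<in> ?bl" "(l, \<tau>) \<in> ?X U" "U' \<in> ?bl" "(l', \<tau>') \<in> ?X U'"
        by blast
      have eq: "cycle_of_list (y # l) \<circ> \<tau> = cycle_of_list (y # l') \<circ> \<tau>'"
        using pq(3) by (simp add: p q del: cycle_of_list.simps)
      note d = D[OF UX(1,2)] and d' = D[OF UX(3,4)]
      have fix_\<tau>: "\<And>x. x \<in> set (y # l) \<Longrightarrow> \<tau> x = x"
        and fix_\<tau>': "\<And>x. x \<in> set (y # l') \<Longrightarrow> \<tau>' x = x"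
        using d(5) d'(5) unfolding d(2) d'(2) by blast+
      note pow = funpow_cycle_of_list_comp[of y l \<tau>, OF d(1) fix_\<tau>]
        and pow' = funpow_cycle_of_list_comp[of y l' \<tau>', OF d'(1) fix_\<tau>']
      have "U = U'"
        using range_funpow_cycle_of_list_comp[of y l \<tau>, OF d(1) fix_\<tau>]
          range_funpow_cycle_of_list_comp[of y l' \<tau>', OF d'(1) fix_\<tau>']
        unfolding eq d(2) d'(2) by blast
      then have len: "length (y # l) = length (y # l')"
        using distinct_card[OF d(1)] distinct_card[OF d'(1)] d(2) d'(2) by simp
      have "y # l = y # l'"
      proof (rule nth_equalityI[OF len])
        fix i assume i: "i < length (y # l)"
        have "(y # l) ! (i mod length (y # l)) = (y # l') ! (i mod length (y # l'))"
          using pow[of i] pow'[of i] unfolding eq by (rule trans[OF sym])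
        then show "(y # l) ! i = (y # l') ! i"
          using i len by (simp only: mod_less)
      qed
      then have "l = l'" by simp
      moreover have "\<tau> = \<tau>'"
      proof -
        have "inj (cycle_of_list (y # l))" using cycle_permutes by (rule permutes_inj)
        then show ?thesis using eq \<open>l = l'\<close> by (simp add: fun_eq_iff inj_eq del: cycle_of_list.simps)
      qed
      ultimately show "p = q" using \<open>U = U'\<close> by (simp add: p q)
    qed
    show "?glue ` Sigma ?bl ?X = good_perms a S"
    proof (intro equalityI subsetI)
      fix \<sigma> assume "\<sigma> \<in> ?glue ` Sigma ?bl ?X"
      then obtain U l \<tau> where U: "U \<in> ?bl" "(l, \<tau>) \<in> ?X U" and \<sigma>: "\<sigma> = cycle_of_list (y # l) \<circ> \<tau>"
        by auto
      note d = D[OF U]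
      have "cycle_of_list (y # l) permutes S"
        using cycle_permutes[of "y # l"] d(2) U(1) permutes_subset by blast
      moreover have "\<tau> permutes S" using d(3) permutes_subset by blast
      ultimately have "\<sigma> permutes S" unfolding \<sigma> using permutes_compose by blast
      then show "\<sigma> \<in> good_perms a S"
        using nonneg_closed_cycle_comp[OF assms(1) d(1), of \<tau> a] d U by (auto simp: good_perms_def \<sigma>)
    next
      fix \<sigma> assume \<sigma>: "\<sigma> \<in> good_perms a S"
      then have perm: "\<sigma> permutes S" by (simp add: good_perms_def)
      then have "permutation \<sigma>" using assms(1) by (auto simp: permutation_permutes)
      define cs where "cs = support \<sigma> y"
      define \<tau> where "\<tau> = (\<lambda>x. if x \<in> S - set cs then \<sigma> x else x)"
      have dist: "distinct cs" unfolding cs_def using \<open>permutation \<sigma>\<close> by (rule cycle_of_permutation)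
      have "cs \<noteq> []" "hd cs = y"
        using least_power_of_permutation(2)[OF \<open>permutation \<sigma>\<close>, of y] by (auto simp: cs_def hd_map)
      then obtain l where cs: "cs = y # l" by (cases cs) auto
      have sub: "set cs \<subseteq> S"
        using permutes_in_image[OF permutes_funpow[OF perm]] assms(2) by (auto simp: cs_def)
      have \<tau>: "\<tau> permutes (S - set cs)"
        unfolding \<tau>_def cs_def using perm assms(1) by (rule semidecomposition)
      have "\<sigma> = cycle_of_list cs \<circ> \<tau>"
      proof
        fix x
        show "\<sigma> x = (cycle_of_list cs \<circ> \<tau>) x"
        proof (cases "x \<in> S - set cs")
          case True
          then have "\<tau> x \<notin> set cs" using permutes_in_image[OF \<tau>, of x] by auto
          then show ?thesis using True id_outside_supp[of "\<tau> x" cs] by (simp add: \<tau>_def)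
        next
          case False
          then show ?thesis
            using cycle_restrict[OF \<open>permutation \<sigma>\<close>, of x y] id_outside_supp[of x cs] perm
            by (cases "x \<in> set cs") (auto simp: \<tau>_def cs_def permutes_def)
        qed
      qed
      moreover have "set cs \<in> ?bl" "(l, \<tau>) \<in> ?X (set cs)"
        using nonneg_closed_cycle_comp[OF assms(1), of y l \<tau> a] \<sigma> sub \<tau> dist calculation
        by (auto simp: cs good_perms_def permutations_of_set_def simp del: cycle_of_list.simps)
      ultimately show "\<sigma> \<in> ?glue ` Sigma ?bl ?X"
        by (intro image_eqI[of _ _ "(set cs, l, \<tau>)"]) (auto simp: cs)
    qed
  qed
  then have "card (good_perms a S) = card (Sigma ?bl ?X)" by (simp add: bij_betw_same_card)
  also have "\<dots> = (\<Sum>U\<in>?bl. card (?X U))"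
    using fin assms(1) by (intro card_SigmaI) (auto intro!: finite_cartesian_product finite_good_perms)
  also have "\<dots> = (\<Sum>U\<in>?bl. fact (card U - 1) * card (good_perms a (S - U)))"
  proof (intro sum.cong refl)
    fix U assume U: "U \<in> ?bl"
    then have "finite U" using assms(1) finite_subset by auto
    then show "card (?X U) = fact (card U - 1) * card (good_perms a (S - U))"
      using U by (simp add: card_cartesian_product card_permutations_of_set)
  qed
  finally show ?thesis .
qed

text \<open>
  Both sides are 1 on the empty set and satisfy the same recurrence.
\<close>

lemma card_good_orders_eq_good_perms:
  assumes "finite S"
  shows "card (good_orders a S) = card (good_perms a S)"
  using assms
proof (induction "card S" arbitrary: S rule: less_induct)
  case less
  show ?case
  proof (cases "S = {}")
    case True
    then show ?thesis by (simp add: card_good_orders_empty card_good_perms_empty)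
  next
    case False
    then obtain y where y: "y \<in> S" by blast
    have "card (good_orders a (S - U)) = card (good_perms a (S - U))" if "y \<in> U" for U
      using less.prems y that by (intro less.hyps psubset_card_mono) auto
    then show ?thesis
      unfolding card_good_orders_by_block[OF less.prems y] card_good_perms_by_cycle[OF less.prems y]
      by (intro sum.cong) auto
  qed
qed

section \<open>Cutting a map and a marked tree along the same forest\<close>

text \<open>
  No nonempty subset of \<open>W\<close> is mapped into itself. For finite \<open>W\<close> this says that iterating \<open>f\<close> from
  any point of \<open>W\<close> eventually leaves \<open>W\<close>; in this form it can be used and established without
  iterating \<open>f\<close>.
\<close>

definition escapes :: "('a \<Rightarrow> 'a) \<Rightarrow> 'a set \<Rightarrow> bool" where
  "escapes f W \<longleftrightarrow> (\<forall>Q\<subseteq>W. f ` Q \<subseteq> Q \<longrightarrow> Q = {})"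

text \<open>
  Parent maps of rooted trees. The root is its own parent, so that trees become special maps.
\<close>

definition tree_maps :: "'a set \<Rightarrow> ('a \<Rightarrow> 'a) set" where
  "tree_maps V = {h \<in> V \<rightarrow>\<^sub>E V. \<exists>r\<in>V. h r = r \<and> escapes h (V - {r})}"

text \<open>
  Parent maps of rooted forests on \<open>V\<close> with the set of roots \<open>P\<close>; roots have no parent here.
\<close>

definition forests :: "'a set \<Rightarrow> 'a set \<Rightarrow> ('a \<Rightarrow> 'a) set" where
  "forests V P = {g \<in> (V - P) \<rightarrow>\<^sub>E V. escapes g (V - P)}"

definition attach :: "'a set \<Rightarrow> ('a \<Rightarrow> 'a) \<Rightarrow> ('a \<Rightarrow> 'a) \<Rightarrow> 'a \<Rightarrow> 'a" where
  "attach P k g x = (if x \<in> P then k x else g x)"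

text \<open>
  Since the recursion equation of \<^const>\<open>while\<close> holds unconditionally, so do the equations for
  \<open>tree_root\<close>; that the iteration ends in \<open>P\<close> is known only for forests.
\<close>

definition tree_root :: "'a set \<Rightarrow> ('a \<Rightarrow> 'a) \<Rightarrow> 'a \<Rightarrow> 'a" where
  "tree_root P g = while (\<lambda>x. x \<notin> P) g"

definition tree_weight :: "('a \<Rightarrow> int) \<Rightarrow> 'a set \<Rightarrow> 'a set \<Rightarrow> ('a \<Rightarrow> 'a) \<Rightarrow> 'a \<Rightarrow> int" where
  "tree_weight a V P g p = sum a {x \<in> V. tree_root P g x = p}"

lemma escapesD: "escapes f W \<Longrightarrow> Q \<subseteq> W \<Longrightarrow> f ` Q \<subseteq> Q \<Longrightarrow> Q = {}"
  by (simp add: escapes_def)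

lemma nonneg_closedD:
  "nonneg_closed a S f \<Longrightarrow> Q \<subseteq> S \<Longrightarrow> (\<And>x. x \<in> S \<Longrightarrow> f x \<in> Q \<Longrightarrow> x \<in> Q) \<Longrightarrow> 0 \<le> sum a Q"
  by (simp add: nonneg_closed_def)

lemma tree_root_unfold: "tree_root P g x = (if x \<in> P then x else tree_root P g (g x))"
  unfolding tree_root_def by (subst while_unfold) simp

lemma tree_root_in [simp]: "x \<in> P \<Longrightarrow> tree_root P g x = x"
  by (simp add: tree_root_unfold)

lemma tree_root_step: "x \<notin> P \<Longrightarrow> tree_root P g x = tree_root P g (g x)"
  by (subst tree_root_unfold) simp

lemma tree_root_mem:
  assumes "g \<in> forests V P" "x \<in> V"
  shows "tree_root P g x \<in> P"
proof -
  let ?Q = "{x \<in> V - P. tree_root P g x \<notin> P}"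
  have "g ` ?Q \<subseteq> ?Q"
  proof
    fix y assume "y \<in> g ` ?Q"
    then obtain x where x: "x \<in> V - P" "tree_root P g x \<notin> P" "y = g x" by blast
    then have "tree_root P g y \<notin> P" using tree_root_step[of x P g] by simp
    moreover have "y \<in> V" using assms(1) x by (auto simp: forests_def)
    ultimately show "y \<in> ?Q" by auto
  qed
  moreover have "escapes g (V - P)" using assms(1) by (simp add: forests_def)
  ultimately have "?Q = {}" by (intro escapesD) auto
  then show ?thesis using assms(2) by (cases "x \<in> P") auto
qed

lemma attach_PiE:
  assumes "P \<subseteq> V" "k ` P \<subseteq> P" "g \<in> (V - P) \<rightarrow>\<^sub>E V"
  shows "attach P k g \<in> V \<rightarrow>\<^sub>E V"
proof (rule PiE_I)
  fix x assume "x \<in> V"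
  then show "attach P k g x \<in> V"
    using assms by (cases "x \<in> P") (auto simp: attach_def dest: PiE_mem)
next
  fix x assume "x \<notin> V"
  then show "attach P k g x = undefined"
    using assms(1,3) PiE_arb[of g "V - P" _ x] by (auto simp: attach_def)
qed

lemma attach_eqD:
  assumes "attach P k g = attach P k' g'" "g \<in> (V - P) \<rightarrow>\<^sub>E V" "g' \<in> (V - P) \<rightarrow>\<^sub>E V"
  shows "g = g'" "\<And>x. x \<in> P \<Longrightarrow> k x = k' x"
proof -
  have eq: "(if x \<in> P then k x else g x) = (if x \<in> P then k' x else g' x)" for x
    using assms(1) by (simp add: attach_def fun_eq_iff)
  show "g = g'"
  proof
    fix x
    show "g x = g' x"
      using eq[of x] assms(2,3) by (cases "x \<in> P") (auto simp: PiE_iff extensional_def)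
  qed
  show "k x = k' x" if "x \<in> P" for x using eq[of x] that by simp
qed

text \<open>
  A set \<open>Q\<close> closed under preimages consists of the full trees of the roots in \<open>Q\<close> and a rest without
  roots. The first part is closed exactly if its set of roots is closed under preimages of \<open>k\<close>, and
  its weight is the sum of the tree weights; the second part concerns the forest alone.
\<close>

lemma nonneg_closed_attach:
  assumes "finite V" "P \<subseteq> V" "g \<in> forests V P" "k ` P \<subseteq> P"
  shows "nonneg_closed a V (attach P k g) \<longleftrightarrow>
    nonneg_closed a (V - P) g \<and> nonneg_closed (tree_weight a V P g) P k"
proof -
  have gV: "g x \<in> V" if "x \<in> V - P" for x using assms(3) that by (auto simp: forests_def)
  have weight: "sum (tree_weight a V P g) Q = sum a {x \<in> V. tree_root P g x \<in> Q}" if "Q \<subseteq> P" for Q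
  proof -
    have "sum (tree_weight a V P g) Q =
        (\<Sum>p\<in>Q. sum a {x \<in> {x \<in> V. tree_root P g x \<in> Q}. tree_root P g x = p})"
      unfolding tree_weight_def by (intro sum.cong refl arg_cong2[of _ _ _ _ sum]) auto
    also have "\<dots> = sum a {x \<in> V. tree_root P g x \<in> Q}"
      using assms(1,2) that by (intro sum.group) (auto intro: finite_subset)
    finally show ?thesis .
  qed
  show ?thesis
  proof (intro iffI conjI)
    assume L: "nonneg_closed a V (attach P k g)"
    show "nonneg_closed a (V - P) g"
      unfolding nonneg_closed_def
    proof (intro allI impI)
      fix Q assume Q: "Q \<subseteq> V - P" "\<forall>x\<in>V - P. g x \<in> Q \<longrightarrow> x \<in> Q"
      then have "\<forall>x\<in>V. attach P k g x \<in> Q \<longrightarrow> x \<in> Q"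
        using assms(4) by (auto simp: attach_def)
      moreover have "Q \<subseteq> V" using Q(1) by blast
      ultimately show "0 \<le> sum a Q" by (intro nonneg_closedD[OF L]) auto
    qed
    show "nonneg_closed (tree_weight a V P g) P k"
      unfolding nonneg_closed_def
    proof (intro allI impI)
      fix Q assume Q: "Q \<subseteq> P" "\<forall>x\<in>P. k x \<in> Q \<longrightarrow> x \<in> Q"
      have "\<forall>x\<in>V. attach P k g x \<in> {x \<in> V. tree_root P g x \<in> Q} \<longrightarrow> x \<in> {x \<in> V. tree_root P g x \<in> Q}"
      proof (intro ballI impI)
        fix x assume x: "x \<in> V" "attach P k g x \<in> {x \<in> V. tree_root P g x \<in> Q}"
        show "x \<in> {x \<in> V. tree_root P g x \<in> Q}"
        proof (cases "x \<in> P")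
          case True
          then have "k x \<in> P" using assms(4) by blast
          then show ?thesis using x Q(2) True by (simp add: attach_def)
        next
          case False
          then show ?thesis using x tree_root_step[OF False, of g] by (simp add: attach_def)
        qed
      qed
      then have "0 \<le> sum a {x \<in> V. tree_root P g x \<in> Q}"
        using L by (simp add: nonneg_closed_def)
      then show "0 \<le> sum (tree_weight a V P g) Q" by (simp add: weight[OF Q(1)])
    qed
  next
    assume R: "nonneg_closed a (V - P) g \<and> nonneg_closed (tree_weight a V P g) P k"
    show "nonneg_closed a V (attach P k g)"
      unfolding nonneg_closed_def
    proof (intro allI impI)
      fix Q assume Q: "Q \<subseteq> V" "\<forall>x\<in>V. attach P k g x \<in> Q \<longrightarrow> x \<in> Q"
      define Q1 where "Q1 = {x \<in> V. tree_root P g x \<in> Q \<inter> P}"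
      have step: "x \<in> Q" if "x \<in> V - P" "g x \<in> Q" for x
        using Q(2) that by (auto simp: attach_def)
      \<comment> \<open>With a root, the set contains its whole tree: a vertex of the tree outside \<open>Q\<close> has its parent
        outside \<open>Q\<close> as well.\<close>
      have "{x \<in> V - P. tree_root P g x \<in> Q \<and> x \<notin> Q} = {}" (is "?Z = {}")
      proof -
        have "g ` ?Z \<subseteq> ?Z"
        proof
          fix y assume "y \<in> g ` ?Z"
          then obtain x where x: "x \<in> V - P" "tree_root P g x \<in> Q" "x \<notin> Q" "y = g x" by blast
          then have "y \<in> V" "y \<notin> Q" "tree_root P g y \<in> Q"
            using gV step tree_root_step[of x P g] by auto
          then show "y \<in> ?Z" by (cases "y \<in> P") auto
        qed
        moreover have "?Z \<subseteq> V - P" by blast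
        moreover have "escapes g (V - P)" using assms(3) by (simp add: forests_def)
        ultimately show ?thesis by (intro escapesD[of g "V - P"])
      qed
      then have "x \<in> Q" if "x \<in> V - P" "tree_root P g x \<in> Q" for x using that by blast
      then have sub: "Q1 \<subseteq> Q" unfolding Q1_def using tree_root_in[of _ P g] by fastforce
      have "sum a Q = sum a (Q - Q1) + sum a Q1"
        using sub finite_subset[OF Q(1) assms(1)] by (intro sum.subset_diff)
      moreover have "0 \<le> sum a Q1"
      proof -
        have "\<forall>x\<in>P. k x \<in> Q \<inter> P \<longrightarrow> x \<in> Q \<inter> P"
          using Q(2) assms(2) by (auto simp: attach_def)
        then have "0 \<le> sum (tree_weight a V P g) (Q \<inter> P)"
          by (intro nonneg_closedD[OF conjunct2[OF R]]) auto
        then show ?thesis by (simp add: weight Q1_def)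
      qed
      moreover have "0 \<le> sum a (Q - Q1)"
      proof -
        have "Q - Q1 \<subseteq> V - P" using Q(1) by (auto simp: Q1_def)
        moreover have "x \<in> Q - Q1" if x: "x \<in> V - P" "g x \<in> Q - Q1" for x
          using step[of x] x tree_root_step[of x P g] gV[of x] by (auto simp: Q1_def)
        ultimately show ?thesis by (intro nonneg_closedD[OF conjunct1[OF R]]) auto
      qed
      ultimately show "0 \<le> sum a Q" by simp
    qed
  qed
qed

text \<open>
  What trees and maps have in common after cutting: a forest with the part of the condition that
  does not involve its roots.
\<close>

definition forest_keys :: "('a \<Rightarrow> int) \<Rightarrow> 'a set \<Rightarrow> ('a set \<times> ('a \<Rightarrow> 'a)) set" where
  "forest_keys a V = {(P, g). P \<subseteq> V \<and> g \<in> forests V P \<and> nonneg_closed a (V - P) g}"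

lemma finite_forest_keys: "finite V \<Longrightarrow> finite (forest_keys a V)"
proof (rule finite_subset)
  assume "finite V"
  then show "finite (SIGMA P:Pow V. (V - P) \<rightarrow>\<^sub>E V)"
    by (intro finite_SigmaI finite_PiE) auto
qed (auto simp: forest_keys_def forests_def)

text \<open>
  The smallest set that is mapped into itself and that every point eventually enters: its image has
  the same properties and hence is the set itself.
\<close>

lemma ex_recurrent_set:
  assumes "finite V" "f ` V \<subseteq> V"
  obtains P where "P \<subseteq> V" "f ` P = P" "escapes f (V - P)"
proof -
  let ?C = "{X. X \<subseteq> V \<and> f ` X \<subseteq> X \<and> escapes f (V - X)}"
  have "finite ?C" using assms(1) by simp
  moreover have "V \<in> ?C" using assms(2) by (simp add: escapes_def)
  then have "?C \<noteq> {}" by (metis empty_iff)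
  ultimately have "\<exists>P\<in>?C. \<forall>X\<in>?C. X \<subseteq> P \<longrightarrow> P = X"
    by (rule finite_has_minimal)
  then obtain P where P: "P \<in> ?C" and min: "\<forall>X\<in>?C. X \<subseteq> P \<longrightarrow> P = X" ..
  have "escapes f (V - f ` P)"
    unfolding escapes_def
  proof (intro allI impI)
    fix Q assume Q: "Q \<subseteq> V - f ` P" "f ` Q \<subseteq> Q"
    have "x \<notin> P" if "x \<in> Q" for x
    proof
      assume "x \<in> P"
      then have "f x \<in> f ` P" "f x \<in> Q" using that Q(2) by auto
      then show False using Q(1) by auto
    qed
    then have "Q \<subseteq> V - P" using Q(1) by auto
    then show "Q = {}" using P Q(2) by (intro escapesD[of f "V - P"]) auto
  qed
  then have "f ` P \<in> ?C" using P by auto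
  then have "f ` P = P" using P min by auto
  then show ?thesis using that[of P] P by simp
qed

text \<open>
  Together with its mirror image this makes the set of recurrent vertices unique.
\<close>

lemma recurrent_set_subset:
  assumes "finite V" "P \<subseteq> V" "f ` P = P" "f ` P' \<subseteq> P'" "escapes f (V - P')"
  shows "P \<subseteq> P'"
proof -
  have "P - P' \<subseteq> f ` (P - P')" using assms(3,4) by blast
  then have "P - P' = f ` (P - P')"
    using assms(1,2) finite_subset by (metis card_seteq card_image_le finite_Diff finite_imageI)
  then have "P - P' = {}" using assms(2) by (intro escapesD[OF assms(5)]) auto
  then show ?thesis by blast
qed

lemma escapes_attach: "escapes (attach P k g) (V - P) \<longleftrightarrow> escapes g (V - P)"
proof -
  have "attach P k g ` Q = g ` Q" if "Q \<subseteq> V - P" for Q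
    using that by (intro image_cong) (auto simp: attach_def)
  then show ?thesis by (auto simp: escapes_def)
qed

lemma attach_permutes_image: "k permutes P \<Longrightarrow> attach P k g ` P = P"
  using permutes_image[of k P] by (simp add: attach_def cong: image_cong)

text \<open>
  A map is the same as its forest of transient vertices together with the permutation that it induces
  on the recurrent ones.
\<close>

lemma card_nonneg_maps:
  assumes "finite V"
  shows "card {f \<in> V \<rightarrow>\<^sub>E V. nonneg_closed a V f} =
    (\<Sum>(P, g)\<in>forest_keys a V. card (good_perms (tree_weight a V P g) P))"
proof -
  let ?K = "forest_keys a V"
  let ?X = "\<lambda>(P, g). good_perms (tree_weight a V P g) P"
  let ?glue = "\<lambda>((P, g), \<sigma>). attach P \<sigma> g"
  have D: "P \<subseteq> V" "g \<in> forests V P" "g \<in> (V - P) \<rightarrow>\<^sub>E V" "\<sigma> permutes P" "\<sigma> ` P \<subseteq> P" "attach P \<sigma> g ` P = P"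
    "escapes (attach P \<sigma> g) (V - P)" "nonneg_closed a (V - P) g"
    "nonneg_closed (tree_weight a V P g) P \<sigma>"
    if "((P, g), \<sigma>) \<in> Sigma ?K ?X" for P g \<sigma>
    using that attach_permutes_image[of \<sigma> P g] permutes_image[of \<sigma> P]
    by (auto simp: forest_keys_def good_perms_def forests_def escapes_attach)
  have "bij_betw ?glue (Sigma ?K ?X) {f \<in> V \<rightarrow>\<^sub>E V. nonneg_closed a V f}"
  proof (rule bij_betw_imageI)
    show "inj_on ?glue (Sigma ?K ?X)"
    proof (rule inj_onI)
      fix p q assume pq: "p \<in> Sigma ?K ?X" "q \<in> Sigma ?K ?X" "?glue p = ?glue q"
      obtain P g \<sigma> P' g' \<sigma>' where p: "p = ((P, g), \<sigma>)" and q: "q = ((P', g'), \<sigma>')"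
        by (metis surj_pair)
      note d = D[OF pq(1)[unfolded p]] and d' = D[OF pq(2)[unfolded q]]
      have eq: "attach P \<sigma> g = attach P' \<sigma>' g'" using pq(3) by (simp add: p q)
      have "P = P'"
        using recurrent_set_subset[OF assms d(1,6) eq_refl[OF d'(6)[folded eq]] d'(7)[folded eq]]
          recurrent_set_subset[OF assms d'(1) d'(6)[folded eq] eq_refl[OF d(6)] d(7)]
        by blast
      moreover have "g = g'" "\<And>x. x \<in> P \<Longrightarrow> \<sigma> x = \<sigma>' x"
        using attach_eqD[of P \<sigma> g \<sigma>' g' V] eq d(3) d'(3) calculation by auto
      moreover have "\<sigma> = \<sigma>'"
      proof
        fix x show "\<sigma> x = \<sigma>' x"
          using calculation d(4) d'(4) by (cases "x \<in> P") (auto simp: permutes_def)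
      qed
      ultimately show "p = q" by (simp add: p q)
    qed
    show "?glue ` Sigma ?K ?X = {f \<in> V \<rightarrow>\<^sub>E V. nonneg_closed a V f}"
    proof (intro equalityI subsetI)
      fix f assume "f \<in> ?glue ` Sigma ?K ?X"
      then obtain P g \<sigma> where f: "f = attach P \<sigma> g" and mem: "((P, g), \<sigma>) \<in> Sigma ?K ?X" by auto
      note d = D[OF mem]
      show "f \<in> {f \<in> V \<rightarrow>\<^sub>E V. nonneg_closed a V f}"
        unfolding f using attach_PiE[OF d(1,5,3)] nonneg_closed_attach[OF assms d(1,2,5)] d(8,9)
        by simp
    next
      fix f assume f: "f \<in> {f \<in> V \<rightarrow>\<^sub>E V. nonneg_closed a V f}"
      then have "f ` V \<subseteq> V" by auto
      then obtain P where P: "P \<subseteq> V" "f ` P = P" "escapes f (V - P)"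
        by (rule ex_recurrent_set[OF assms])
      define \<sigma> where "\<sigma> x = (if x \<in> P then f x else x)" for x
      define g where "g = restrict f (V - P)"
      have fin: "finite P" using P(1) assms finite_subset by blast
      have \<sigma>: "\<sigma> permutes P"
      proof (rule bij_imp_permutes)
        have "\<sigma> ` P = P" using P(2) by (simp add: \<sigma>_def cong: image_cong)
        then show "bij_betw \<sigma> P P"
          using fin by (simp add: bij_betw_def eq_card_imp_inj_on)
      qed (simp add: \<sigma>_def)
      have fa: "f = attach P \<sigma> g"
        using f P(1) by (auto simp: fun_eq_iff attach_def \<sigma>_def g_def PiE_iff extensional_def)
      have g: "g \<in> forests V P"
      proof -
        have "g \<in> (V - P) \<rightarrow>\<^sub>E V"
          unfolding g_def using f by (auto simp: PiE_iff)
        moreover have "escapes g (V - P)"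
          using P(3) escapes_attach[of P \<sigma> g V] by (simp flip: fa)
        ultimately show ?thesis by (simp add: forests_def)
      qed
      have "\<sigma> ` P \<subseteq> P" using permutes_image[OF \<sigma>] by simp
      then have "((P, g), \<sigma>) \<in> Sigma ?K ?X"
        using nonneg_closed_attach[OF assms P(1) g, of \<sigma> a] f P(1) g \<sigma>
        by (simp add: forest_keys_def good_perms_def flip: fa)
      then show "f \<in> ?glue ` Sigma ?K ?X"
        using fa by (intro image_eqI[of _ _ "((P, g), \<sigma>)"]) auto
    qed
  qed
  then have "card {f \<in> V \<rightarrow>\<^sub>E V. nonneg_closed a V f} = card (Sigma ?K ?X)"
    by (simp add: bij_betw_same_card)
  also have "\<dots> = (\<Sum>k\<in>?K. card (?X k))"
    using assms finite_forest_keys[OF assms]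
    by (intro card_SigmaI) (auto simp: forest_keys_def intro!: finite_good_perms intro: finite_subset)
  also have "\<dots> = (\<Sum>(P, g)\<in>?K. card (good_perms (tree_weight a V P g) P))"
    by (intro sum.cong) auto
  finally show ?thesis .
qed


text \<open>
  The map on the elements of a path that moves one step towards its last element, the root, and
  fixes the root.
\<close>

fun up_next :: "'a list \<Rightarrow> 'a \<Rightarrow> 'a" where
  "up_next [] v = v"
| "up_next [x] v = x"
| "up_next (x # y # p) v = (if v = x then y else up_next (y # p) v)"

lemma up_next_mem: "v \<in> set p \<Longrightarrow> up_next p v \<in> set p"
  by (induction p v rule: up_next.induct) auto

lemma up_next_last: "distinct p \<Longrightarrow> p \<noteq> [] \<Longrightarrow> up_next p (last p) = last p"
proof (induction p rule: induct_list012)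
  case (3 x y p)
  have "last (y # p) \<in> set (y # p)" by (rule last_in_set) simp
  then have "last (y # p) \<noteq> x" using 3(3) by auto
  then show ?case using 3(2,3) by simp
qed auto

text \<open>
  Closed under preimages means: with each vertex of the path, the set contains all earlier ones.
\<close>

lemma up_next_closed_iff:
  assumes "distinct p" "Q \<subseteq> set p"
  shows "(\<forall>v\<in>set p. up_next p v \<in> Q \<longrightarrow> v \<in> Q) \<longleftrightarrow> (\<exists>k\<le>length p. Q = set (take k p))"
proof
  assume "\<forall>v\<in>set p. up_next p v \<in> Q \<longrightarrow> v \<in> Q"
  then show "\<exists>k\<le>length p. Q = set (take k p)"
    using assms
  proof (induction p arbitrary: Q rule: induct_list012)
    case 1
    then show ?case by simp
  next
    case (2 x)
    then have "Q = {} \<or> Q = {x}" by auto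
    then show ?case by (auto intro: exI[of _ 0] exI[of _ 1])
  next
    case (3 x y p)
    have "\<exists>k\<le>length (y # p). Q - {x} = set (take k (y # p))"
    proof (rule 3(2))
      show "\<forall>v\<in>set (y # p). up_next (y # p) v \<in> Q - {x} \<longrightarrow> v \<in> Q - {x}"
      proof (intro ballI impI)
        fix v assume v: "v \<in> set (y # p)" "up_next (y # p) v \<in> Q - {x}"
        then have "v \<noteq> x" using 3(4) by auto
        then show "v \<in> Q - {x}" using v 3(3)[rule_format, of v] by simp
      qed
    qed (use 3(4,5) in auto)
    then obtain k where k: "k \<le> length (y # p)" "Q - {x} = set (take k (y # p))" by blast
    show ?case
    proof (cases k)
      case 0
      then have "Q = {} \<or> Q = {x}" using k by auto
      then show ?thesis by (auto intro: exI[of _ 0] exI[of _ 1])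
    next
      case (Suc j)
      then have "y \<in> Q" using k(2) by auto
      then have "x \<in> Q" using 3(3) by simp
      then have "Q = insert x (Q - {x})" by blast
      then have "Q = set (take (Suc k) (x # y # p))" using k(2) by simp
      then show ?thesis using k(1) by (intro exI[of _ "Suc k"]) simp
    qed
  qed
next
  assume "\<exists>k\<le>length p. Q = set (take k p)"
  then obtain k where "Q = set (take k p)" by blast
  moreover have "\<forall>v\<in>set p. up_next p v \<in> set (take k p) \<longrightarrow> v \<in> set (take k p)"
    using assms(1)
  proof (induction p arbitrary: k rule: induct_list012)
    case (3 x y p)
    show ?case
    proof (cases k)
      case (Suc j)
      show ?thesis
      proof (intro ballI impI)
        fix v assume v: "v \<in> set (x # y # p)" "up_next (x # y # p) v \<in> set (take k (x # y # p))"
        show "v \<in> set (take k (x # y # p))"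
        proof (cases "v = x")
          case False
          then have mem: "v \<in> set (y # p)" and "up_next (y # p) v \<in> insert x (set (take j (y # p)))"
            using v by (auto simp: Suc)
          moreover have "up_next (y # p) v \<noteq> x"
            using up_next_mem[OF mem] 3(3) by auto
          ultimately have "v \<in> set (take j (y # p))" using 3(2)[of j] 3(3) by auto
          then show ?thesis by (simp add: Suc)
        qed (simp add: Suc)
      qed
    qed simp
  qed auto
  ultimately show "\<forall>v\<in>set p. up_next p v \<in> Q \<longrightarrow> v \<in> Q" by simp
qed

lemma nonneg_closed_up_next:
  assumes "distinct p"
  shows "nonneg_closed a (set p) (up_next p) \<longleftrightarrow> (\<forall>k\<le>length p. 0 \<le> sum a (set (take k p)))"
proof -
  have "nonneg_closed a (set p) (up_next p) \<longleftrightarrow>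
      (\<forall>Q\<subseteq>set p. (\<exists>k\<le>length p. Q = set (take k p)) \<longrightarrow> 0 \<le> sum a Q)"
    unfolding nonneg_closed_def using up_next_closed_iff[OF assms] by simp
  also have "\<dots> \<longleftrightarrow> (\<forall>k\<le>length p. 0 \<le> sum a (set (take k p)))"
    by (metis set_take_subset)
  finally show ?thesis .
qed

text \<open>
  A set that is closed under going up the path, but avoids the root at its end, avoids the path.
\<close>

lemma up_next_escape:
  assumes "\<And>v. v \<in> set p \<Longrightarrow> v \<in> Q \<Longrightarrow> up_next p v \<in> Q" "last p \<notin> Q" "distinct p" "p \<noteq> []"
  shows "set p \<inter> Q = {}"
  using assms
proof (induction p rule: induct_list012)
  case (3 x y p)
  have "set (y # p) \<inter> Q = {}"
  proof (rule 3(2))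
    fix v assume v: "v \<in> set (y # p)" "v \<in> Q"
    then have "v \<noteq> x" using 3(5) by auto
    then show "up_next (y # p) v \<in> Q" using 3(3)[of v] v by simp
  qed (use 3(4,5) in auto)
  moreover have "x \<notin> Q" using 3(3)[of x] calculation by auto
  ultimately show ?case by simp
qed auto

text \<open>
  A path that follows \<open>h\<close> and ends at the first fixed point it meets.
\<close>

fun up_path :: "('a \<Rightarrow> 'a) \<Rightarrow> 'a list \<Rightarrow> bool" where
  "up_path h [] \<longleftrightarrow> False"
| "up_path h [x] \<longleftrightarrow> h x = x"
| "up_path h (x # y # p) \<longleftrightarrow> h x = y \<and> x \<noteq> y \<and> up_path h (y # p)"

lemma up_path_unique:
  "up_path h p \<Longrightarrow> up_path h q \<Longrightarrow> hd p = hd q \<Longrightarrow> p = q"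
proof (induction p arbitrary: q rule: induct_list012)
  case (2 x)
  then show ?case by (cases q; cases "tl q") auto
next
  case (3 x y p)
  then obtain p' where q: "q = x # y # p'" by (cases q; cases "tl q") auto
  have "y # p = y # p'" using 3(3,4) by (intro 3(2)) (auto simp: q)
  then show ?case by (simp add: q)
qed simp

lemma up_path_suffix: "up_path h (u @ v) \<Longrightarrow> v \<noteq> [] \<Longrightarrow> up_path h v"
proof (induction u)
  case (Cons x u)
  then show ?case by (cases "u @ v") auto
qed simp

text \<open>
  If the path came back to a vertex, then the part from there on would be another such path with the
  same start but of smaller length.
\<close>

lemma up_path_distinct: "up_path h p \<Longrightarrow> distinct p"
proof (induction p rule: induct_list012)
  case (3 x y p)
  have "x \<notin> set (y # p)"
  proof
    assume "x \<in> set (y # p)"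
    then obtain u v where uv: "y # p = u @ x # v" by (auto simp only: in_set_conv_decomp)
    have "up_path h (y # p)" using 3(3) by simp
    then have "up_path h (x # v)" unfolding uv by (rule up_path_suffix) simp
    then have "x # v = x # y # p" using 3(3) by (intro up_path_unique[of h]) auto
    then show False using arg_cong[OF uv, of length] by simp
  qed
  then show ?case using 3 by simp
qed auto

lemma up_path_iff:
  assumes "distinct p" "p \<noteq> []"
  shows "up_path h p \<longleftrightarrow> (\<forall>v\<in>set p. h v = up_next p v)"
  using assms
proof (induction p rule: induct_list012)
  case (3 x y p)
  have "(\<forall>v\<in>set (y # p). h v = up_next (x # y # p) v) \<longleftrightarrow> (\<forall>v\<in>set (y # p). h v = up_next (y # p) v)"
    using 3(3) by (intro ball_cong refl) auto
  then show ?case using 3 by auto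
qed auto

text \<open>
  The points without such a path would form a set that is mapped into itself and avoids the root.
\<close>

lemma ex_up_path:
  assumes "h \<in> V \<rightarrow>\<^sub>E V" "h r = r" "escapes h (V - {r})" "w \<in> V"
  shows "\<exists>p. up_path h p \<and> hd p = w \<and> set p \<subseteq> V \<and> last p = r"
proof -
  let ?good = "\<lambda>w. \<exists>p. up_path h p \<and> hd p = w \<and> set p \<subseteq> V \<and> last p = r"
  let ?Q = "{w \<in> V. \<not> ?good w}"
  have r: "?good r" if "r \<in> V" using assms(2) that by (intro exI[of _ "[r]"]) auto
  have "h ` ?Q \<subseteq> ?Q"
  proof
    fix y assume "y \<in> h ` ?Q"
    then obtain x where x: "x \<in> V" "\<not> ?good x" and y: "y = h x" by blast
    have "\<not> ?good y"
    proof
      assume "?good y"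
      then obtain p where p: "up_path h p" "hd p = y" "set p \<subseteq> V" "last p = r" by blast
      then obtain p' where p': "p = y # p'" by (cases p) auto
      show False
      proof (cases "x = y")
        case True
        then show False using x \<open>?good y\<close> by simp
      next
        case False
        then have "up_path h (x # p)" using p(1) y by (simp add: p')
        then have "?good x" using p x by (intro exI[of _ "x # p"]) (auto simp: p')
        then show False using x by simp
      qed
    qed
    then show "y \<in> ?Q" using PiE_mem[OF assms(1) x(1)] y by simp
  qed
  then have "?Q = {}" using r by (intro escapesD[OF assms(3)]) auto
  then show ?thesis using assms(4) by blast
qed

text \<open>
  The product with \<open>card V\<close> accounts for a marked vertex. A tree with a marked vertex is the same as
  the path from the marked vertex to the root together with the forest that hangs on the path. The
  empty \<open>V\<close> is excluded because the empty path marks no vertex.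
\<close>

lemma card_marked_nonneg_trees:
  assumes "finite V" "V \<noteq> {}"
  shows "card V * card {h \<in> tree_maps V. nonneg_closed a V h} =
    (\<Sum>(P, g)\<in>forest_keys a V. card (good_orders (tree_weight a V P g) P))"
proof -
  let ?K = "forest_keys a V"
  let ?X = "\<lambda>(P, g). good_orders (tree_weight a V P g) P"
  let ?glue = "\<lambda>((P, g), p). (attach P (up_next p) g, hd p)"
  let ?T = "{h \<in> tree_maps V. nonneg_closed a V h}"
  have D: "P \<subseteq> V" "g \<in> forests V P" "g \<in> (V - P) \<rightarrow>\<^sub>E V" "up_next p ` P \<subseteq> P" "distinct p" "set p = P"
    "p \<noteq> []" "up_path (attach P (up_next p) g) p"
    "escapes g (V - P)" "nonneg_closed a (V - P) g"
    "nonneg_closed (tree_weight a V P g) P (up_next p)"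
    if "((P, g), p) \<in> Sigma ?K ?X" for P g p
  proof -
    show *: "P \<subseteq> V" "g \<in> forests V P" "g \<in> (V - P) \<rightarrow>\<^sub>E V" "distinct p" "set p = P"
      "escapes g (V - P)" "nonneg_closed a (V - P) g"
      using that by (auto simp: forest_keys_def forests_def good_orders_def)
    show "up_next p ` P \<subseteq> P" using up_next_mem[of _ p] *(5) by auto
    show "nonneg_closed (tree_weight a V P g) P (up_next p)"
      using that nonneg_closed_up_next[OF *(4), of "tree_weight a V P g"] *(5)
      by (auto simp: good_orders_def)
    show ne': "p \<noteq> []"
    proof
      assume "p = []"
      then have "P = {}" using *(5) by simp
      then have "V = {}"
        using *(3,6) by (intro escapesD[of g V]) auto
      then show False using assms(2) by simp
    qed
    show "up_path (attach P (up_next p) g) p"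
      using *(5) by (simp add: up_path_iff[OF *(4) ne'] attach_def)
  qed
  have "bij_betw ?glue (Sigma ?K ?X) (?T \<times> V)"
  proof (rule bij_betw_imageI)
    show "inj_on ?glue (Sigma ?K ?X)"
    proof (rule inj_onI)
      fix s t assume st: "s \<in> Sigma ?K ?X" "t \<in> Sigma ?K ?X" "?glue s = ?glue t"
      obtain P g p P' g' p' where s: "s = ((P, g), p)" and t: "t = ((P', g'), p')"
        by (metis surj_pair)
      note d = D[OF st(1)[unfolded s]] and d' = D[OF st(2)[unfolded t]]
      have eq: "attach P (up_next p) g = attach P' (up_next p') g'" "hd p = hd p'"
        using st(3) by (simp_all add: s t)
      have "p = p'" using up_path_unique[OF d(8) _ eq(2)] d'(8) eq(1) by simp
      then have "P = P'" using d(6) d'(6) by simp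
      then have "g = g'" using attach_eqD(1)[of P _ g _ g' V] eq(1) d(3) d'(3) by metis
      then show "s = t" using \<open>p = p'\<close> \<open>P = P'\<close> by (simp add: s t)
    qed
    show "?glue ` Sigma ?K ?X = ?T \<times> V"
    proof (intro equalityI subsetI)
      fix z assume "z \<in> ?glue ` Sigma ?K ?X"
      then obtain P g p where z: "z = (attach P (up_next p) g, hd p)"
        and mem: "((P, g), p) \<in> Sigma ?K ?X" by auto
      note d = D[OF mem]
      let ?h = "attach P (up_next p) g"
      have "?h \<in> tree_maps V"
        unfolding tree_maps_def
      proof (intro CollectI conjI bexI)
        show "?h \<in> V \<rightarrow>\<^sub>E V" by (rule attach_PiE[OF d(1,4,3)])
        have last: "last p \<in> P" using d(6,7) by (metis last_in_set)
        then show "?h (last p) = last p" by (simp add: attach_def up_next_last d(5,7))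
        show "last p \<in> V" using last d(1) by blast
        show "escapes ?h (V - {last p})"
          unfolding escapes_def
        proof (intro allI impI)
          fix Q assume Q: "Q \<subseteq> V - {last p}" "?h ` Q \<subseteq> Q"
          have "set p \<inter> Q = {}"
          proof (rule up_next_escape[OF _ _ d(5,7)])
            fix v assume v: "v \<in> set p" "v \<in> Q"
            then have "?h v \<in> Q" using Q(2) by blast
            then show "up_next p v \<in> Q" using v d(6) by (simp add: attach_def)
          qed (use Q in blast)
          then have sub: "Q \<subseteq> V - P" using Q(1) d(6) by blast
          show "Q = {}"
            using d(9) sub Q(2) by (intro escapesD[of ?h "V - P"]) (simp_all only: escapes_attach)
        qed
      qed
      moreover have "nonneg_closed a V ?h"
        using nonneg_closed_attach[OF assms(1) d(1,2,4)] d(10,11) by simp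
      moreover have "hd p \<in> V" using d(1,6,7) by (metis hd_in_set subsetD)
      ultimately show "z \<in> ?T \<times> V" by (simp add: z)
    next
      fix z assume z: "z \<in> ?T \<times> V"
      then obtain h w r where zh: "z = (h, w)" "h \<in> V \<rightarrow>\<^sub>E V" "w \<in> V" "nonneg_closed a V h"
        and r: "h r = r" "escapes h (V - {r})"
        by (auto simp: tree_maps_def)
      obtain p where p: "up_path h p" "hd p = w" "set p \<subseteq> V" "last p = r"
        using ex_up_path[OF zh(2) r zh(3)] by blast
      define P where "P = set p"
      define g where "g = restrict h (V - P)"
      have dist: "distinct p" using p(1) by (rule up_path_distinct)
      have ne': "p \<noteq> []" using p(1) by auto
      have P: "P \<subseteq> V" using p(3) by (simp add: P_def)
      have hp: "h v = up_next p v" if "v \<in> P" for v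
        using p(1) that unfolding up_path_iff[OF dist ne'] P_def by blast
      have h: "h = attach P (up_next p) g"
      proof
        fix x
        show "h x = attach P (up_next p) g x"
          using hp[of x] P PiE_arb[OF zh(2), of x] by (auto simp: attach_def g_def restrict_def)
      qed
      have g: "g \<in> forests V P"
      proof -
        have "g \<in> (V - P) \<rightarrow>\<^sub>E V"
          unfolding g_def using zh(2) by (auto simp: PiE_iff)
        moreover have "escapes h (V - P)"
          unfolding escapes_def
        proof (intro allI impI)
          fix Q assume Q: "Q \<subseteq> V - P" "h ` Q \<subseteq> Q"
          have "r \<in> P" using p(4) ne' by (auto simp: P_def)
          then show "Q = {}" using Q by (intro escapesD[OF r(2)]) auto
        qed
        then have "escapes g (V - P)"
          using escapes_attach[of P "up_next p" g V] by (simp flip: h)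
        ultimately show ?thesis by (simp add: forests_def)
      qed
      have "up_next p ` P \<subseteq> P" using up_next_mem[of _ p] by (auto simp: P_def)
      then have "nonneg_closed a (V - P) g" "nonneg_closed (tree_weight a V P g) P (up_next p)"
        using nonneg_closed_attach[OF assms(1) P g, of "up_next p" a] zh(4) by (simp_all flip: h)
      then have "((P, g), p) \<in> Sigma ?K ?X"
        using P g dist nonneg_closed_up_next[OF dist, of "tree_weight a V P g"]
        by (simp add: forest_keys_def good_orders_def P_def)
      then show "z \<in> ?glue ` Sigma ?K ?X"
        using h p(2) zh(1) by (intro image_eqI[of _ _ "((P, g), p)"]) auto
    qed
  qed
  then have "card (?T \<times> V) = card (Sigma ?K ?X)"
    by (simp add: bij_betw_same_card)
  also have "\<dots> = (\<Sum>k\<in>?K. card (?X k))"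
    using assms finite_forest_keys[OF assms(1)]
    by (intro card_SigmaI) (auto simp: forest_keys_def intro!: finite_good_orders intro: finite_subset)
  also have "\<dots> = (\<Sum>(P, g)\<in>?K. card (good_orders (tree_weight a V P g) P))"
    by (intro sum.cong) auto
  finally show ?thesis by (simp add: card_cartesian_product mult.commute)
qed

text \<open>
  For each forest, the orders of the roots are replaced by permutations.
\<close>

lemma card_tree_maps_eq_card_maps:
  assumes "finite V" "V \<noteq> {}"
  shows "card V * card {h \<in> tree_maps V. nonneg_closed a V h} =
    card {f \<in> V \<rightarrow>\<^sub>E V. nonneg_closed a V f}"
  unfolding card_marked_nonneg_trees[OF assms] card_nonneg_maps[OF assms(1)]
proof (intro sum.cong refl, clarify)
  fix P g assume "(P, g) \<in> forest_keys a V"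
  then have "finite P" using assms(1) by (auto simp: forest_keys_def intro: finite_subset)
  then show "card (good_orders (tree_weight a V P g) P) = card (good_perms (tree_weight a V P g) P)"
    by (rule card_good_orders_eq_good_perms)
qed

section \<open>Source trees as parent maps\<close>

text \<open>
  The loop at the root is left out, as a source tree has no arc into its root.
\<close>

definition parent_digraph :: "'a set \<Rightarrow> ('a \<Rightarrow> 'a) \<Rightarrow> 'a pair_pre_digraph" where
  "parent_digraph V h = \<lparr> pverts = V, parcs = {(h i, i) | i. i \<in> V \<and> h i \<noteq> i} \<rparr>"

text \<open>
  Two paths from \<open>r\<close> to \<open>b\<close> with different last steps would connect \<open>a\<close> and \<open>a'\<close> without using \<open>b\<close>,
  and closing this connection through \<open>b\<close> gives a cycle of length at least 3.
\<close>

lemma last_step_unique: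
  assumes "undirected_tree T"
    and "pre_digraph.apath (with_proj T) r (p @ [(a, b)]) b"
    and "pre_digraph.apath (with_proj T) r (p' @ [(a', b)]) b"
  shows "a = a'"
proof (rule ccontr)
  assume "a \<noteq> a'"
  interpret pair_graph T using assms(1) by (simp add: undirected_tree_def)
  have path: "awalk r p a" "b \<notin> set (awalk_verts r p)" "(a, b) \<in> parcs T"
    if "apath r (p @ [(a, b)]) b" for p a
  proof -
    have *: "apath r p (awlast r p)" "apath (awlast r p) [(a, b)] b"
      "set (awalk_verts r p) \<inter> set (tl (awalk_verts (awlast r p) [(a, b)])) = {}"
      using that unfolding apath_append_iff by auto
    have "fst (a, b) = awlast r p" "(a, b) \<in> parcs T"
      using *(2) unfolding apath_Cons_iff by blast+
    then have "awlast r p = a" and arc: "(a, b) \<in> parcs T" by simp_all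
    then show "awalk r p a" using awalkI_apath[OF *(1)] by (simp only:)
    have "tl (awalk_verts (awlast r p) [(a, b)]) = [b]" by simp
    then show "b \<notin> set (awalk_verts r p)" using *(3) by (simp only:) simp
    show "(a, b) \<in> parcs T" by (rule arc)
  qed
  note P = path[OF assms(2)] and P' = path[OF assms(3)]
  define W where "W = rev_path p @ p'"
  have rev: "awalk a (rev_path p) r" using P(1) by simp
  then have W: "awalk a W a'" unfolding W_def using P'(1) by (rule awalk_appendI)
  have avoid: "fst e \<noteq> b \<and> snd e \<noteq> b" if "e \<in> set W" for e
  proof -
    have "fst e \<in> set (awalk_verts r p) \<union> set (awalk_verts r p')
      \<and> snd e \<in> set (awalk_verts r p) \<union> set (awalk_verts r p')"
    proof (cases "e \<in> set p'")
      case True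
      then show ?thesis
        using awalk_verts_arc1[of e p' r] awalk_verts_arc2[OF P'(1), of e] by simp
    next
      case False
      then have "e \<in> set (rev_path p)" using that by (simp add: W_def)
      then show ?thesis
        using awalk_verts_arc1[of e "rev_path p" a] awalk_verts_arc2[OF rev, of e]
          awalk_verts_rev_path[OF P(1)] by simp
    qed
    then show ?thesis using P(2) P'(2) by auto
  qed
  define q where "q = awalk_to_apath W"
  have q: "apath a q a'" unfolding q_def using W by (rule apath_awalk_to_apath)
  have ab: "a \<noteq> b" using P(3) no_loops' by blast
  have "b \<notin> set (awalk_verts a q)"
    using set_awalk_verts[OF awalkI_apath[OF q]] avoid awalk_to_apath_subset[OF W] ab
    by (auto simp: q_def)
  moreover have "q \<noteq> []" using q \<open>a \<noteq> a'\<close> by (auto simp: apath_Nil_iff)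
  moreover have verts: "awalk_verts a (q @ [(a', b)]) = awalk_verts a q @ [b]"
  proof -
    have "awlast a q = a'" using awalkI_apath[OF q] by (auto elim: awalkE')
    then have "snd (last q) = a'" using \<open>q \<noteq> []\<close> by (simp add: awalk_verts_conv)
    then show ?thesis using \<open>q \<noteq> []\<close> by (simp add: awalk_verts_conv)
  qed
  let ?c = "(b, a) # q @ [(a', b)]"
  have "awalk b ?c b"
  proof -
    have "awalk a' [(a', b)] b" using arc_implies_awalk[of "(a', b)"] P'(3) by simp
    then have "awalk a (q @ [(a', b)]) b" by (rule awalk_appendI[OF awalkI_apath[OF q]])
    then show ?thesis
      using arcs_symmetric[OF P(3)] unfolding awalk_Cons_iff by simp
  qed
  then have "cycle ?c"
    using q calculation verts unfolding cycle_def by (auto simp: apath_def intro!: exI[of _ b])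
  moreover have "length ?c \<ge> 3" using \<open>q \<noteq> []\<close> by (cases q) auto
  ultimately show False using assms(1) by (auto simp: undirected_tree_def)
qed

text \<open>
  The parent of a vertex is where the last step of a path from the root comes from. Every vertex
  escapes to the root because a path to its parent is obtained by dropping the last step.
\<close>

lemma orient_away_eq_parent_digraph:
  assumes "undirected_tree T" "r \<in> pverts T"
  obtains h where "h \<in> pverts T \<rightarrow>\<^sub>E pverts T" "h r = r" "escapes h (pverts T - {r})"
    "orient_away T r = parent_digraph (pverts T) h"
proof -
  interpret pair_graph T using assms(1) by (simp add: undirected_tree_def)
  let ?V = "pverts T"
  define E where "E = parcs (orient_away T r)"
  have E: "(a, b) \<in> E \<longleftrightarrow> (\<exists>p. apath r (p @ [(a, b)]) b)" for a b
    by (auto simp: E_def orient_away_def apath_def awalk_simps)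
  have unique: "a = a'" if "(a, b) \<in> E" "(a', b) \<in> E" for a a' b
    using that last_step_unique[OF assms(1)] unfolding E by blast
  have "strongly_connected (with_proj T)"
    using assms(1) sym_arcs by (intro symmetric_connected_imp_strongly_connected) (auto simp: undirected_tree_def)
  then have ex_path: "\<exists>p. apath r p v" if "v \<in> ?V" for v
    using that assms(2) by (auto simp: reachable_apath[symmetric])
  have last_step: "\<exists>q a. p = q @ [(a, v)] \<and> apath r q a \<and> (a, v) \<in> E"
    if "apath r p v" "v \<noteq> r" for p v
  proof -
    have "p \<noteq> []" using that by (auto simp: apath_Nil_iff)
    then obtain q e where p: "p = q @ [e]" using rev_exhaust by blast
    have "apath r q (awlast r q)" "apath (awlast r q) [e] v"
      using that(1) unfolding p apath_append_iff by auto
    then have "apath r q (fst e)" "snd e = v" by (auto simp: apath_simps)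
    then have "apath r q (fst e)" "e = (fst e, v)" by auto
    then show ?thesis using that(1) E p by metis
  qed
  define h where "h v = (if v = r then r else if v \<in> ?V then THE a. (a, v) \<in> E else undefined)" for v
  have h_eq: "h v = a" if "(a, v) \<in> E" for a v
  proof -
    obtain p where "apath r (p @ [(a, v)]) v" using \<open>(a, v) \<in> E\<close> E by blast
    then have "v \<noteq> r" "v \<in> ?V"
      using apath_nonempty_ends[of r "p @ [(a, v)]" v] awalk_last_in_verts[OF awalkI_apath] by auto
    moreover have "(THE a. (a, v) \<in> E) = a" using that unique by (intro the_equality)
    ultimately show ?thesis by (simp add: h_def)
  qed
  have h_arc: "(h v, v) \<in> E" if "v \<in> ?V" "v \<noteq> r" for v
  proof -
    obtain p where "apath r p v" using ex_path[OF \<open>v \<in> ?V\<close>] by blast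
    then obtain a where "(a, v) \<in> E" using last_step[OF _ \<open>v \<noteq> r\<close>] by blast
    then show ?thesis using h_eq by simp
  qed
  have E_arcs: "a \<in> ?V \<and> b \<in> ?V \<and> a \<noteq> b \<and> b \<noteq> r" if ab: "(a, b) \<in> E" for a b
  proof -
    obtain p where p: "apath r (p @ [(a, b)]) b" using ab unfolding E by (rule exE)
    have "(a, b) \<in> parcs T" using ab by (auto simp: E_def orient_away_def)
    then show ?thesis
      using in_arcsD1 in_arcsD2 no_loops' apath_nonempty_ends[OF p] by blast
  qed
  have hr: "h r = r" by (simp add: h_def)
  show ?thesis
  proof (rule that)
    show "h \<in> ?V \<rightarrow>\<^sub>E ?V"
    proof (rule PiE_I)
      fix x assume "x \<in> ?V"
      then show "h x \<in> ?V"
        using h_arc[of x] E_arcs[of "h x" x] assms(2) hr by (cases "x = r") simp_all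
    qed (use assms(2) in \<open>auto simp: h_def\<close>)
    show "h r = r" by (rule hr)
    show "escapes h (?V - {r})"
      unfolding escapes_def
    proof (intro allI impI)
      fix Q assume Q: "Q \<subseteq> ?V - {r}" "h ` Q \<subseteq> Q"
      have "v \<notin> Q" if "apath r p v" for p v
        using that
      proof (induction p arbitrary: v rule: rev_induct)
        case Nil
        then show ?case using Q(1) by (auto simp: apath_Nil_iff)
      next
        case (snoc e p)
        then have "v \<noteq> r" using apath_nonempty_ends by blast
        then obtain a where a: "apath r p a" "(a, v) \<in> E"
          using last_step[OF snoc.prems] by auto
        show ?case
        proof
          assume "v \<in> Q"
          then have "a \<in> Q" using Q(2) h_eq[OF a(2)] by blast
          then show False using snoc.IH[OF a(1)] by simp
        qed
      qed
      then show "Q = {}" using ex_path Q(1) by blast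
    qed
    have "E = {(h i, i) | i. i \<in> ?V \<and> h i \<noteq> i}"
    proof (intro equalityI subsetI)
      fix e assume e: "e \<in> E"
      obtain a b where "e = (a, b)" by (cases e)
      then show "e \<in> {(h i, i) | i. i \<in> ?V \<and> h i \<noteq> i}"
        using e h_eq[of a b] E_arcs[of a b] by auto
    next
      fix e assume "e \<in> {(h i, i) | i. i \<in> ?V \<and> h i \<noteq> i}"
      then obtain i where "e = (h i, i)" "i \<in> ?V" "h i \<noteq> i" by blast
      then show "e \<in> E" using h_arc[of i] hr by (cases "i = r") simp_all
    qed
    then show "orient_away T r = parent_digraph ?V h"
      by (simp add: parent_digraph_def E_def orient_away_def)
  qed
qed

definition undirected_of :: "'a set \<Rightarrow> ('a \<Rightarrow> 'a) \<Rightarrow> 'a pair_pre_digraph" where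
  "undirected_of V h = \<lparr> pverts = V,
     parcs = {(a, b). a \<in> V \<and> b \<in> V \<and> a \<noteq> b \<and> (h a = b \<or> h b = a)} \<rparr>"

lemma pair_graph_undirected_of: "finite V \<Longrightarrow> pair_graph (undirected_of V h)"
proof -
  assume fin: "finite V"
  then have "finite (parcs (undirected_of V h))"
    by (intro finite_subset[of "parcs (undirected_of V h)" "V \<times> V"]) (auto simp: undirected_of_def)
  then show ?thesis
    using fin by unfold_locales (auto simp: undirected_of_def symmetric_def sym_def)
qed

text \<open>
  In the list \<open>p\<close> of arcs of a closed walk, the predecessor \<open>x\<close> and the successor \<open>y\<close> of \<open>v\<close> differ
  if the walk visits at least three vertices, none of them twice.
\<close>

lemma closed_walk_neighbours:
  assumes "map fst p @ [u] = u # map snd p" "distinct (map snd p)" "3 \<le> length p"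
    and "v \<in> snd ` set p"
  shows "\<exists>x\<in>snd ` set p. \<exists>y\<in>snd ` set p. x \<noteq> y \<and> (x, v) \<in> set p \<and> (v, y) \<in> set p"
proof -
  let ?n = "length p"
  have nth: "(map fst p @ [u]) ! i = (u # map snd p) ! i" for i using assms(1) by simp
  obtain i where i: "i < ?n" "v = snd (p ! i)" using assms(4) by (auto simp: in_set_conv_nth)
  \<comment> \<open>The positions of the arcs before and after the \<open>i\<close>-th one, read cyclically.\<close>
  define j where "j = (if i = 0 then ?n - 1 else i - 1)"
  define k where "k = (if i = ?n - 1 then 0 else Suc i)"
  have jk: "j < ?n" "k < ?n" "j \<noteq> k" using assms(3) i(1) by (auto simp: j_def k_def)
  have first: "fst (p ! 0) = snd (p ! (?n - 1))"
    using nth[of 0] nth[of ?n] assms(3) by (cases p) (auto simp: nth_append nth_Cons')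
  have step: "fst (p ! Suc l) = snd (p ! l)" if "Suc l < ?n" for l
    using nth[of "Suc l"] that by (simp add: nth_append)
  have "fst (p ! i) = snd (p ! j)"
    using first step[of "i - 1"] i(1) by (auto simp: j_def)
  then have "p ! i = (snd (p ! j), v)" using i(2) by (simp add: prod_eq_iff)
  moreover have "fst (p ! k) = v"
    using first step[of i] i by (auto simp: k_def)
  then have "p ! k = (v, snd (p ! k))" by (simp add: prod_eq_iff)
  moreover have "snd (p ! j) \<noteq> snd (p ! k)"
    using assms(2) jk by (auto simp: distinct_conv_nth)
  moreover have "p ! i \<in> set p" "p ! j \<in> set p" "p ! k \<in> set p" using i jk by simp_all
  ultimately show ?thesis by (metis imageI)
qed

text \<open>
  Of two different neighbours of a vertex on a cycle at most one is its parent, so each vertex of the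
  cycle has a child on the cycle. By counting, each vertex of the cycle is then the parent of exactly
  one vertex of the cycle; so the root is not on the cycle, and \<open>h\<close> maps the cycle to itself, which
  is impossible.
\<close>

lemma undirected_tree_undirected_of:
  assumes "finite V" "h \<in> V \<rightarrow>\<^sub>E V" "r \<in> V" "h r = r" "escapes h (V - {r})"
  shows "undirected_tree (undirected_of V h)"
proof -
  let ?T = "undirected_of V h"
  interpret pair_graph ?T using pair_graph_undirected_of[OF assms(1)] .
  have V: "pverts ?T = V" by (simp add: undirected_of_def)
  have hV: "h x \<in> V" if "x \<in> V" for x using that assms(2) by blast
  have arc: "(x, h x) \<in> parcs ?T" if "x \<in> V" "h x \<noteq> x" for x
    using that hV by (auto simp: undirected_of_def)
  have to_root: "v \<rightarrow>\<^sup>*\<^bsub>with_proj ?T\<^esub> r" if "v \<in> V" for v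
  proof -
    have "{v \<in> V. \<not> v \<rightarrow>\<^sup>*\<^bsub>with_proj ?T\<^esub> r} = {}"
    proof (rule escapesD[OF assms(5)])
      show "{v \<in> V. \<not> v \<rightarrow>\<^sup>*\<^bsub>with_proj ?T\<^esub> r} \<subseteq> V - {r}" using assms(3) V by auto
      show "h ` {v \<in> V. \<not> v \<rightarrow>\<^sup>*\<^bsub>with_proj ?T\<^esub> r} \<subseteq> {v \<in> V. \<not> v \<rightarrow>\<^sup>*\<^bsub>with_proj ?T\<^esub> r}"
      proof
        fix y assume "y \<in> h ` {v \<in> V. \<not> v \<rightarrow>\<^sup>*\<^bsub>with_proj ?T\<^esub> r}"
        then obtain x where x: "x \<in> V" "\<not> x \<rightarrow>\<^sup>*\<^bsub>with_proj ?T\<^esub> r" "y = h x" by blast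
        have "\<not> y \<rightarrow>\<^sup>*\<^bsub>with_proj ?T\<^esub> r"
        proof
          assume y: "y \<rightarrow>\<^sup>*\<^bsub>with_proj ?T\<^esub> r"
          show False
          proof (cases "y = x")
            case False
            then have "(x, y) \<in> parcs ?T" using arc[of x] x by simp
            then have "x \<rightarrow>\<^sup>*\<^bsub>with_proj ?T\<^esub> r" using y by (intro adj_reachable_trans[of x y]) simp_all
            then show False using x by simp
          qed (use x y in simp)
        qed
        then show "y \<in> {v \<in> V. \<not> v \<rightarrow>\<^sup>*\<^bsub>with_proj ?T\<^esub> r}" using x hV by simp
      qed
    qed
    then show ?thesis using that by blast
  qed
  have reach: "u \<rightarrow>\<^sup>*\<^bsub>with_proj ?T\<^esub> v" if "u \<in> V" "v \<in> V" for u v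
  proof -
    have "r \<rightarrow>\<^sup>*\<^bsub>with_proj ?T\<^esub> v"
      using symmetric_reachable[OF sym_arcs to_root[OF \<open>v \<in> V\<close>]] .
    then show ?thesis by (rule reachable_trans[OF to_root[OF \<open>u \<in> V\<close>]])
  qed
  have conn: "connected (with_proj ?T)"
    unfolding connected_def
  proof (rule strongly_connectedI)
    show "verts (with_proj (mk_symmetric (with_proj ?T))) \<noteq> {}" using V assms(3) by auto
    fix u v assume "u \<in> verts (with_proj (mk_symmetric (with_proj ?T)))"
      "v \<in> verts (with_proj (mk_symmetric (with_proj ?T)))"
    then show "u \<rightarrow>\<^sup>*\<^bsub>with_proj (mk_symmetric (with_proj ?T))\<^esub> v"
      using reach V by (intro reachable_mk_symmetricI) simp
  qed
  have acyclic: False if cyc: "cycle p" and len: "length p \<ge> 3" for p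
  proof -
    obtain u where u: "awalk u p u" "distinct (tl (awalk_verts u p))" "p \<noteq> []"
      using cyc by (auto simp: cycle_def)
    have closed: "map fst p @ [u] = u # map snd p"
    proof -
      have "map fst p @ [snd (last p)] = fst (hd p) # map snd p"
        using u awalk_verts_conv[of u p] awalk_verts_conv'[of u p u] by (auto simp: awalk_def)
      moreover have "fst (hd p) = u" "snd (last p) = u"
        using u(1,3) awalk_verts_conv[of u p] by (auto elim!: awalkE' simp: cas_simp)
      ultimately show ?thesis by (simp only:)
    qed
    have dist: "distinct (map snd p)"
      using u awalk_verts_conv'[of u p u] by (auto simp: awalk_def)
    define C where "C = snd ` set p"
    have arcs: "e \<in> parcs ?T" if "e \<in> set p" for e
      using u(1) that unfolding awalk_def by auto
    have CV: "C \<subseteq> V" using arcs by (auto simp: C_def undirected_of_def)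
    then have fin: "finite C" using assms(1) finite_subset by blast
    have child: "\<exists>c\<in>C - {r}. h c = v" if "v \<in> C" for v
    proof -
      obtain x y where xy: "x \<noteq> y" "x \<in> C" "y \<in> C" "(x, v) \<in> set p" "(v, y) \<in> set p"
        using closed_walk_neighbours[OF closed dist len \<open>v \<in> C\<close>[unfolded C_def]]
        unfolding C_def by blast
      note arcs' = arcs[OF xy(4)] arcs[OF xy(5)]
      have "h x = v \<or> h y = v" using arcs' xy(1) by (auto simp: undirected_of_def)
      moreover have "x \<noteq> v" "y \<noteq> v" using arcs' by (auto simp: undirected_of_def)
      ultimately have "\<exists>c\<in>C. h c = v \<and> c \<noteq> v" using xy(2,3) by fast
      then show ?thesis using assms(4) by (metis DiffI singletonD)
    qed
    have sub: "C \<subseteq> h ` (C - {r})"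
    proof
      fix v assume "v \<in> C"
      from child[OF this] obtain c where "c \<in> C - {r}" "h c = v" ..
      then show "v \<in> h ` (C - {r})" by (intro image_eqI) simp_all
    qed
    have "r \<notin> C"
    proof
      assume "r \<in> C"
      then have "card (C - {r}) < card C" using fin by (rule card_Diff1_less[rotated])
      moreover have "card C \<le> card (C - {r})"
        using card_mono[OF _ sub] card_image_le[of "C - {r}" h] fin by simp
      ultimately show False by simp
    qed
    then have "C \<subseteq> h ` C" using sub by simp
    then have "C = h ` C"
      using card_image_le[OF fin, of h] by (intro card_seteq) (simp_all add: fin)
    then have "C = {}" using CV \<open>r \<notin> C\<close> by (intro escapesD[OF assms(5)]) auto
    then show False using u(3) by (simp add: C_def)
  qed
  show ?thesis
    unfolding undirected_tree_def using pair_graph conn acyclic by auto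
qed

text \<open>
  Orienting the tree away from \<open>r\<close> gives some parent map \<open>h'\<close>. At a vertex \<open>v\<close> where \<open>h'\<close> and \<open>h\<close>
  differ, \<open>h'\<close> moves to a neighbour that is a child of \<open>v\<close> for \<open>h\<close>. There the two maps differ again,
  since otherwise \<open>h'\<close> would go back and forth between the two vertices. So the set of these vertices
  is mapped into itself by \<open>h'\<close>.
\<close>

lemma parent_digraph_eq_orient_away:
  assumes "finite V" "h \<in> V \<rightarrow>\<^sub>E V" "r \<in> V" "h r = r" "escapes h (V - {r})"
  shows "orient_away (undirected_of V h) r = parent_digraph V h"
proof -
  let ?T = "undirected_of V h"
  have V: "pverts ?T = V" by (simp add: undirected_of_def)
  have "undirected_tree ?T" using undirected_tree_undirected_of[OF assms] .
  then obtain h' where h': "h' \<in> V \<rightarrow>\<^sub>E V" "h' r = r" "escapes h' (V - {r})"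
    "orient_away ?T r = parent_digraph V h'"
    using orient_away_eq_parent_digraph[of ?T r] assms(3) unfolding V by blast
  have nbr: "h (h' v) = v \<and> h' v \<noteq> v" if v: "v \<in> V" "h' v \<noteq> h v" "v \<noteq> r" for v
  proof -
    have "h' v \<noteq> v"
    proof
      assume "h' v = v"
      then have "{v} = {}" using v by (intro escapesD[OF h'(3)]) auto
      then show False by simp
    qed
    then have "(h' v, v) \<in> parcs (orient_away ?T r)"
      using v unfolding h'(4) by (auto simp: parent_digraph_def)
    then have "(h' v, v) \<in> parcs ?T" by (simp add: orient_away_def)
    then show ?thesis using v \<open>h' v \<noteq> v\<close> by (auto simp: undirected_of_def)
  qed
  let ?Q = "{v \<in> V. h' v \<noteq> h v}"
  have sub: "?Q \<subseteq> V - {r}" using h'(2) assms(4) by auto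
  have "?Q = {}"
  proof (rule escapesD[OF h'(3) sub])
    show "h' ` ?Q \<subseteq> ?Q"
    proof
      fix y assume "y \<in> h' ` ?Q"
      then obtain v where v: "v \<in> V" "h' v \<noteq> h v" "y = h' v" by blast
      then have "v \<noteq> r" using sub by blast
      then have hy: "h y = v" "y \<noteq> v" using nbr v by auto
      have "y \<noteq> r" using hy assms(4) by auto
      have yV: "y \<in> V" using h'(1) v by auto
      have "h' y \<noteq> v"
      proof
        assume "h' y = v"
        then have "{y, v} = {}"
          using v yV \<open>y \<noteq> r\<close> \<open>v \<noteq> r\<close> by (intro escapesD[OF h'(3)]) auto
        then show False by simp
      qed
      then show "y \<in> ?Q" using hy yV by simp
    qed
  qed
  then have "h' = h" using h'(1) assms(2) by (intro PiE_ext[of h' V "\<lambda>_. V" h]) auto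
  then show ?thesis using h'(4) by simp
qed

lemma source_trees_eq: "source_trees n = parent_digraph {1..n} ` tree_maps {1..n}"
proof (intro equalityI subsetI)
  fix D assume "D \<in> source_trees n"
  then obtain T r where T: "D = orient_away T r" "undirected_tree T" "pverts T = {1..n}" "r \<in> {1..n}"
    by (auto simp: source_trees_def)
  obtain h where "h \<in> {1..n} \<rightarrow>\<^sub>E {1..n}" "h r = r" "escapes h ({1..n} - {r})"
    "D = parent_digraph {1..n} h"
    using orient_away_eq_parent_digraph[OF T(2), of r] T(4) unfolding T(1,3) by blast
  then show "D \<in> parent_digraph {1..n} ` tree_maps {1..n}"
    using T(4) unfolding tree_maps_def by blast
next
  fix D assume "D \<in> parent_digraph {1..n} ` tree_maps {1..n}"
  then obtain h r where h: "D = parent_digraph {1..n} h" "h \<in> {1..n} \<rightarrow>\<^sub>E {1..n}" "r \<in> {1..n}" "h r = r"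
    "escapes h ({1..n} - {r})"
    by (auto simp: tree_maps_def)
  have "D = orient_away (undirected_of {1..n} h) r"
    using parent_digraph_eq_orient_away[OF _ h(2-5)] h(1) by simp
  moreover have "undirected_tree (undirected_of {1..n} h)"
    using undirected_tree_undirected_of[OF _ h(2-5)] by simp
  moreover have "pverts (undirected_of {1..n} h) = {1..n}" by (simp add: undirected_of_def)
  ultimately show "D \<in> source_trees n" using h(3) unfolding source_trees_def by blast
qed

section \<open>Exchanging the order of counting\<close>

text \<open>
  The digraph may or may not have the loops that come from fixed points of \<open>h\<close>, since a loop imposes
  no condition on a closed set. This covers source trees and inverse mapping digraphs alike.
\<close>

lemma parking_function_of_map:
  assumes "finite V" "h \<in> V \<rightarrow>\<^sub>E V" "pverts D = V"
    and "parcs D \<subseteq> {(h i, i) | i. i \<in> V}" "{(h i, i) | i. i \<in> V \<and> h i \<noteq> i} \<subseteq> parcs D"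
  shows "parking_function D s \<longleftrightarrow> set s \<subseteq> V \<and> nonneg_closed (weight s) V h"
proof -
  have "fst e \<in> V \<and> snd e \<in> V" if e: "e \<in> parcs D" for e
  proof -
    obtain i where "e = (h i, i)" "i \<in> V" using e assms(4) by blast
    then show ?thesis using PiE_mem[OF assms(2)] by simp
  qed
  then have wf: "pair_wf_digraph D" by unfold_locales (auto simp: assms(3))
  have "closed_under (parcs D) Q \<longleftrightarrow> (\<forall>x\<in>V. h x \<in> Q \<longrightarrow> x \<in> Q)" for Q
  proof
    assume cl: "closed_under (parcs D) Q"
    show "\<forall>x\<in>V. h x \<in> Q \<longrightarrow> x \<in> Q"
    proof (intro ballI impI)
      fix x assume x: "x \<in> V" "h x \<in> Q"
      show "x \<in> Q"
      proof (cases "h x = x")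
        case False
        then have "(h x, x) \<in> parcs D" using assms(5) x(1) by blast
        then show ?thesis using cl x(2) by (auto simp: closed_under_def)
      qed (use x in simp)
    qed
  next
    assume "\<forall>x\<in>V. h x \<in> Q \<longrightarrow> x \<in> Q"
    then show "closed_under (parcs D) Q" using assms(4) by (auto simp: closed_under_def)
  qed
  then show ?thesis
    using parking_function_iff[OF _ wf, of s] assms(1,3) by (simp add: nonneg_closed_def)
qed

lemma sum_num_parking_functions:
  assumes "finite V" "finite \<H>" "inj_on D \<H>"
    and "\<And>h s. h \<in> \<H> \<Longrightarrow>
      parking_function (D h) s \<longleftrightarrow> set s \<subseteq> V \<and> nonneg_closed (weight s) V h"
  shows "(\<Sum>d\<in>D ` \<H>. num_parking_functions d m) =
    (\<Sum>s | set s \<subseteq> V \<and> length s = m. card {h \<in> \<H>. nonneg_closed (weight s) V h})"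
proof -
  let ?S = "{s. set s \<subseteq> V \<and> length s = m}"
  have fin: "finite ?S" using assms(1) by (rule finite_lists_length_eq)
  have "(\<Sum>d\<in>D ` \<H>. num_parking_functions d m) = (\<Sum>h\<in>\<H>. num_parking_functions (D h) m)"
    using assms(3) by (simp add: sum.reindex)
  also have "\<dots> = (\<Sum>h\<in>\<H>. \<Sum>s | s \<in> ?S \<and> nonneg_closed (weight s) V h. 1)"
  proof (rule sum.cong)
    fix h assume "h \<in> \<H>"
    then have "{s. length s = m \<and> parking_function (D h) s} =
        {s. s \<in> ?S \<and> nonneg_closed (weight s) V h}"
      using assms(4) by auto
    then show "num_parking_functions (D h) m = (\<Sum>s | s \<in> ?S \<and> nonneg_closed (weight s) V h. 1)"
      unfolding num_parking_functions_def card_eq_sum by (simp only:)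
  qed simp
  also have "\<dots> = (\<Sum>s\<in>?S. \<Sum>h | h \<in> \<H> \<and> nonneg_closed (weight s) V h. 1)"
    using fin assms(2) by (intro sum.swap_restrict)
  finally show ?thesis by (simp only: card_eq_sum)
qed

lemma source_tree_parking_total_eq:
  "source_tree_parking_total n m = (\<Sum>s | set s \<subseteq> {1..n} \<and> length s = m.
     card {h \<in> tree_maps {1..n}. nonneg_closed (weight s) {1..n} h})"
  unfolding source_tree_parking_total_def source_trees_eq
proof (rule sum_num_parking_functions)
  let ?V = "{1..n}"
  have sub: "tree_maps ?V \<subseteq> ?V \<rightarrow>\<^sub>E ?V" by (auto simp: tree_maps_def)
  then show "finite (tree_maps ?V)" by (rule finite_subset) (simp add: finite_PiE)
  show "inj_on (parent_digraph ?V) (tree_maps ?V)"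
  proof (rule inj_onI)
    fix h h' assume h: "h \<in> tree_maps ?V" "h' \<in> tree_maps ?V"
      and eq: "parent_digraph ?V h = parent_digraph ?V h'"
    have arcs: "{(h i, i) | i. i \<in> ?V \<and> h i \<noteq> i} = {(h' i, i) | i. i \<in> ?V \<and> h' i \<noteq> i}"
      using eq by (simp add: parent_digraph_def)
    have "h i = h' i" if "i \<in> ?V" for i
    proof (rule ccontr)
      assume ne: "h i \<noteq> h' i"
      show False
      proof (cases "h i = i")
        case True
        then have "(h' i, i) \<in> {(h i, i) | i. i \<in> ?V \<and> h i \<noteq> i}"
          unfolding arcs using ne that by auto
        then show False using True by auto
      next
        case False
        then have "(h i, i) \<in> {(h' i, i) | i. i \<in> ?V \<and> h' i \<noteq> i}"
          unfolding arcs[symmetric] using that by auto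
        then show False using ne by auto
      qed
    qed
    moreover have "h \<in> ?V \<rightarrow>\<^sub>E ?V" "h' \<in> ?V \<rightarrow>\<^sub>E ?V" using h sub by auto
    ultimately show "h = h'" by (intro PiE_ext[of h ?V "\<lambda>_. ?V" h'])
  qed
  fix h s assume "h \<in> tree_maps ?V"
  then show "parking_function (parent_digraph ?V h) s \<longleftrightarrow>
      set s \<subseteq> ?V \<and> nonneg_closed (weight s) ?V h"
    using sub by (intro parking_function_of_map) (auto simp: parent_digraph_def)
qed simp

lemma inverse_mapping_parking_total_eq:
  "inverse_mapping_parking_total n m = (\<Sum>s | set s \<subseteq> {1..n} \<and> length s = m.
     card {f \<in> {1..n} \<rightarrow>\<^sub>E {1..n}. nonneg_closed (weight s) {1..n} f})"
proof -
  let ?V = "{1..n}"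
  have "inverse_mapping_digraphs n = inverse_mapping_digraph n ` (?V \<rightarrow>\<^sub>E ?V)"
  proof (intro equalityI subsetI)
    fix D assume "D \<in> inverse_mapping_digraphs n"
    then obtain f where f: "D = inverse_mapping_digraph n f" "f \<in> ?V \<rightarrow> ?V"
      by (auto simp: inverse_mapping_digraphs_def)
    have "D = inverse_mapping_digraph n (restrict f ?V)"
      unfolding f(1) inverse_mapping_digraph_def by auto
    moreover have "restrict f ?V \<in> ?V \<rightarrow>\<^sub>E ?V" using f(2) by auto
    ultimately show "D \<in> inverse_mapping_digraph n ` (?V \<rightarrow>\<^sub>E ?V)" by blast
  next
    fix D assume "D \<in> inverse_mapping_digraph n ` (?V \<rightarrow>\<^sub>E ?V)"
    then show "D \<in> inverse_mapping_digraphs n"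
      by (auto simp: inverse_mapping_digraphs_def PiE_def)
  qed
  then show ?thesis
    unfolding inverse_mapping_parking_total_def
  proof (simp only:, intro sum_num_parking_functions)
    show "finite (?V \<rightarrow>\<^sub>E ?V)" by (simp add: finite_PiE)
    show "inj_on (inverse_mapping_digraph n) (?V \<rightarrow>\<^sub>E ?V)"
    proof (rule inj_onI)
      fix f f' assume f: "f \<in> ?V \<rightarrow>\<^sub>E ?V" "f' \<in> ?V \<rightarrow>\<^sub>E ?V"
        and "inverse_mapping_digraph n f = inverse_mapping_digraph n f'"
      then have arcs: "{(f i, i) | i. i \<in> ?V} = {(f' i, i) | i. i \<in> ?V}"
        by (simp add: inverse_mapping_digraph_def)
      have "f i = f' i" if "i \<in> ?V" for i
      proof -
        have "(f i, i) \<in> {(f' i, i) | i. i \<in> ?V}" unfolding arcs[symmetric] using that by blast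
        then show ?thesis by blast
      qed
      then show "f = f'" using f by (intro PiE_ext[of f ?V "\<lambda>_. ?V" f'])
    qed
    fix f s assume "f \<in> ?V \<rightarrow>\<^sub>E ?V"
    then show "parking_function (inverse_mapping_digraph n f) s \<longleftrightarrow>
        set s \<subseteq> ?V \<and> nonneg_closed (weight s) ?V f"
      by (intro parking_function_of_map) (auto simp: inverse_mapping_digraph_def)
  qed simp
qed

theorem theorem4:
  fixes n m :: nat
  assumes "n \<ge> 1" and "m \<le> n"
  shows "n * source_tree_parking_total n m = inverse_mapping_parking_total n m"
proof -
  have "n * card {h \<in> tree_maps {1..n}. nonneg_closed (weight s) {1..n} h} =
      card {f \<in> {1..n} \<rightarrow>\<^sub>E {1..n}. nonneg_closed (weight s) {1..n} f}" for s
    using card_tree_maps_eq_card_maps[of "{1..n}" "weight s"] assms(1) by simp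
  then show ?thesis
    by (simp add: source_tree_parking_total_eq inverse_mapping_parking_total_eq sum_distrib_left)
qed

end
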